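(* Let $N\ge3$ and let $q\in\mathbb C^\times$ be generic. In the quantum affine algebra $U_q(\widehat{\mathfrak{gl}}_N)$ define, for $m\in\mathbb Z\setminus\{0\}$, $$a_{Nm}=q^{Nm+|m|/2}\left(\frac{|m|}m\,\frac{\epsilon_{1m}+q^{|m|}\epsilon_{2m}+\cdots+q^{(N-1)|m|}\epsilon_{Nm}}{(1+q^{2|m|}+\cdots+q^{2(N-1)|m|})^{1/2}}+\epsilon_{Nm}\right),$$ $$a_{im}=\sum_{j=i}^{N-1}q^{jm}\big(q^{|m|/2}\epsilon_{jm}-q^{-|m|/2}\epsilon_{j+1,m}\big)+a_{Nm}\qquad(1\le i\le N-1).$$ Then $U_q(\widehat{\mathfrak{gl}}_N)$ is isomorphic to the associative algebra generated by $a_{im}$, $q^{c/2}$, $k_{i0}^{\pm1}$, $x^\pm_{jn}$ ($1\le i\le N$, $1\le j\le N-1$, $n\in\mathbb Z$, $m\in\mathbb Z\setminus\{0\}$), with $q^{c/2}$ central, subject to the commutation relations (R1)–(R4) of the context (where $h_{im}=q^{-im}(a_{im}-a_{i+1,m})$ in terms of the new generators) and $$[a_{im},a_{in}]=0,\qquad [a_{im},a_{jn}]=-\frac{[m]}m[mc]\,q^{m}\,\delta_{m,-n}\quad(i>j),$$ $$[a_{im},x^\pm_{jn}]=0\quad(j\ne i,i-1),$$ $$[a_{im},x^\pm_{in}]=\pm\frac{[m]}m q^{(i-1)m\mp|m|c/2}x^\pm_{i,m+n},\qquad [a_{i+1,m},x^\pm_{in}]=\mp\frac{[m]}m q^{(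i+1)m\mp|m|c/2}x^\pm_{i,m+n}.$$
   Context: Generic $q$: nonzero and not a root of unity; $q^{1/2}$ is fixed, and for each $|m|$ a square root $(1+q^{2|m|}+\cdots+q^{2(N-1)|m|})^{1/2}$ is fixed (the same for $m$ and $-m$). $[m]=\frac{q^m-q^{-m}}{q-q^{-1}}$, $[mc]=\frac{q^{mc}-q^{-mc}}{q-q^{-1}}$. $(a_{ij})_{1\le i,j\le N-1}$ is the Cartan matrix of type $A_{N-1}$ (not to be confused with the generators $a_{im}$). **$U_q(\widehat{\mathfrak{gl}}_N)$** is the unital associative algebra generated by $\epsilon_{im}$, $k_{i0}^{\pm1}$ ($1\le i\le N$, $m\in\mathbb Z\setminus\{0\}$), $x^\pm_{jn}$ ($1\le j\le N-1$, $n\in\mathbb Z$) and $q^{c/2}$, subject to the relations that $q^{c/2}$ is central, the relations - $[\epsilon_{im},\epsilon_{jn}]=\frac{[m]}m[mc]\delta_{ij}\delta_{m,-n}$; - $[\epsilon_{im},x^\pm_{jn}]=0$ for $j\ne i,i-1$; - $[\epsilon_{im},x^\pm_{in}]=\pm\frac{[m]}mq^{\mp|m|c/2+|m|/2}x^\pm_{i,m+n}$; - $[\epsilon_{im},x^\pm_{i-1,n}]=\mp\frac{[m]}mq^{\mp|m|c/2-|m|/2}x^\pm_{i-1,m+n}$; and the following (R1)–(R4), with $h_{im}=q^{|m|/2}\epsilon_{im}-q^{-|m|/2}\epsilon_{i+1,m}$ for $1\le i\le N-1$: - (R1) $x^\pm_{i,m+1}x^\pm_{jn}-q^{\pm a_{ij}}x^\pm_{jn}x^\pm_{i,m+1}=q^{\pm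 a_{ij}}x^\pm_{im}x^\pm_{j,n+1}-x^\pm_{j,n+1}x^\pm_{im}$; - (R2) $[x^\pm_{im},x^\pm_{jn}]=0$ for $|i-j|>1$; - (R3) $[x^+_{im},x^-_{jn}]=\frac{\delta_{ij}}{q-q^{-1}}(k^+_{i,m+n}q^{(m-n)c/2}-k^-_{i,m+n}q^{(n-m)c/2})$, where $\sum_{n\ge0}k^\pm_{i,\pm n}z^{\mp n}=k_{i0}^{\pm1}\exp(\pm(q-q^{-1})\sum_{n>0}h_{i,\pm n}z^{\mp n})$ and the other $k^\pm_{i,n}$ are $0$; - (R4) $x^\pm_{im_1}x^\pm_{im_2}x^\pm_{jn}-(q+q^{-1})x^\pm_{im_1}x^\pm_{jn}x^\pm_{im_2}+x^\pm_{jn}x^\pm_{im_1}x^\pm_{im_2}+\{m_1\leftrightarrow m_2\}=0$ for $|i-j|=1$. *)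

theory Defs
  imports "HOL-Library.Poly_Mapping" "HOL-Computational_Algebra.Formal_Power_Series"
    "HOL-Algebra.QuotRing" "HOL-Algebra.Module"
begin

section \<open>Unital associative complex algebras given by generators and relations\<close>

text \<open>Words form the free monoid. It is written additively because the convolution product of
  \<^theory>\<open>HOL-Library.Poly_Mapping\<close> is indexed by an additive (not necessarily commutative)
  monoid; finitely supported complex functions on words then form the free algebra.\<close>

datatype 'g fmon = Word (letters: "'g list")

instantiation fmon :: (type) monoid_add
begin
definition zero_fmon :: "'a fmon" where "zero_fmon = Word []"
definition plus_fmon :: "'a fmon \<Rightarrow> 'a fmon \<Rightarrow> 'a fmon"
  where "plus_fmon u v = Word (letters u @ letters v)"
instance by standard (simp_all add: zero_fmon_def plus_fmon_def)
end

type_synonym 'g falg = "'g fmon \<Rightarrow>\<^sub>0 complex"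

definition sc :: "complex \<Rightarrow> 'g falg"
  where "sc c = Poly_Mapping.single 0 c"

definition var :: "'g \<Rightarrow> 'g falg"
  where "var g = Poly_Mapping.single (Word [g]) 1"

text \<open>The free algebra on a set \<open>G\<close> of generators; the record type of modules is used only to
  carry the scalar multiplication along with the ring structure.\<close>

definition free_alg :: "'g set \<Rightarrow> (complex, 'g falg) module"
  where "free_alg G =
    \<lparr>carrier = {p. \<forall>w \<in> Poly_Mapping.keys p. set (letters w) \<subseteq> G},
     mult = (*), one = 1, zero = 0, add = (+), smult = (\<lambda>c p. sc c * p)\<rparr>"

definition quot_alg :: "(complex, 'x) module \<Rightarrow> 'x set \<Rightarrow> (complex, 'x set) module"
  where "quot_alg A I = ring.extend (A Quot I)
    (module.fields (\<lambda>c X. \<Union>x\<in>X. I +>\<^bsub>A\<^esub> (c \<odot>\<^bsub>A\<^esub> x)))"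

definition rel_ideal :: "'g set \<Rightarrow> 'g falg set \<Rightarrow> 'g falg set"
  where "rel_ideal G R = Idl\<^bsub>free_alg G\<^esub> R"

text \<open>The algebra with generators \<open>G\<close> and relations \<open>p = 0\<close> for \<open>p \<in> R\<close>
  (the ideals of HOL-Algebra are two-sided), and the class of an element of the free algebra.\<close>

definition presented_alg :: "'g set \<Rightarrow> 'g falg set \<Rightarrow> (complex, 'g falg set) module"
  where "presented_alg G R = quot_alg (free_alg G) (rel_ideal G R)"

definition cls :: "'g set \<Rightarrow> 'g falg set \<Rightarrow> 'g falg \<Rightarrow> 'g falg set"
  where "cls G R p = rel_ideal G R +>\<^bsub>free_alg G\<^esub> p"

definition alg_iso :: "(complex, 'x) module \<Rightarrow> (complex, 'y) module \<Rightarrow> ('x \<Rightarrow> 'y) set"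
  where "alg_iso A B =
    {\<phi> \<in> ring_iso A B. \<forall>c. \<forall>x \<in> carrier A. \<phi> (c \<odot>\<^bsub>A\<^esub> x) = c \<odot>\<^bsub>B\<^esub> \<phi> x}"

definition comm :: "'g falg \<Rightarrow> 'g falg \<Rightarrow> 'g falg"
  where "comm a b = a * b - b * a"

text \<open>The exponential of a power series without constant term. Only finitely many powers
  contribute to each coefficient, so this makes sense over the noncommutative free algebra.\<close>

definition fexp :: "'g falg fps \<Rightarrow> 'g falg fps"
  where "fexp f = fps_compose (Abs_fps (\<lambda>k. sc (1 / fact k))) f"


section \<open>Generators\<close>

datatype sign = Pl | Mi

fun sg :: "sign \<Rightarrow> int" where
  "sg Pl = 1"
| "sg Mi = -1"

text \<open>\<open>K Pl i\<close>, \<open>K Mi i\<close> stand for $k_{i0}^{\pm 1}$, \<open>X Pl j n\<close>, \<open>X Mi j n\<close> for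
  $x^\pm_{jn}$ and \<open>Qc Pl\<close>, \<open>Qc Mi\<close> for $q^{\pm c/2}$ (the inverse of $q^{c/2}$ occurs in the
  relations). The generators \<open>Eps i m\<close> are used by the first and \<open>Ag i m\<close>, for $a_{im}$, by the
  second of the two presentations.\<close>

datatype gen = Eps nat int | Ag nat int | K sign nat | X sign nat int | Qc sign

type_synonym alg = "gen falg"

definition common_gens :: "nat \<Rightarrow> gen set"
  where "common_gens N = {K \<sigma> i | \<sigma> i. 1 \<le> i \<and> i \<le> N}
    \<union> {X \<sigma> j n | \<sigma> j n. 1 \<le> j \<and> j \<le> N - 1} \<union> range Qc"

definition eps_gens :: "nat \<Rightarrow> gen set"
  where "eps_gens N = {Eps i m | i m. 1 \<le> i \<and> i \<le> N \<and> m \<noteq> 0} \<union> common_gens N"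

definition a_gens :: "nat \<Rightarrow> gen set"
  where "a_gens N = {Ag i m | i m. 1 \<le> i \<and> i \<le> N \<and> m \<noteq> 0} \<union> common_gens N"

abbreviation ep :: "nat \<Rightarrow> int \<Rightarrow> alg" where "ep i m \<equiv> var (Eps i m)"
abbreviation av :: "nat \<Rightarrow> int \<Rightarrow> alg" where "av i m \<equiv> var (Ag i m)"
abbreviation kv :: "sign \<Rightarrow> nat \<Rightarrow> alg" where "kv \<sigma> i \<equiv> var (K \<sigma> i)"
abbreviation xv :: "sign \<Rightarrow> nat \<Rightarrow> int \<Rightarrow> alg" where "xv \<sigma> j n \<equiv> var (X \<sigma> j n)"

text \<open>\<open>cpow t\<close> is $(q^{c/2})^t = q^{tc/2}$.\<close>

definition cpow :: "int \<Rightarrow> alg"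
  where "cpow t = (if t \<ge> 0 then var (Qc Pl) ^ nat t else var (Qc Mi) ^ nat (- t))"


section \<open>Relations\<close>

definition generic :: "complex \<Rightarrow> bool"
  where "generic q \<longleftrightarrow> q \<noteq> 0 \<and> (\<forall>n::nat. n \<ge> 1 \<longrightarrow> q ^ n \<noteq> 1)"

definition qint :: "complex \<Rightarrow> int \<Rightarrow> complex"
  where "qint q m = (q powi m - q powi (- m)) / (q - inverse q)"

text \<open>The element $[mc]$.\<close>

definition qintc :: "complex \<Rightarrow> int \<Rightarrow> alg"
  where "qintc q m = sc (1 / (q - inverse q)) * (cpow (2 * m) - cpow (- (2 * m)))"

definition cartan :: "nat \<Rightarrow> nat \<Rightarrow> int"
  where "cartan i j = (if i = j then 2 else if \<bar>int i - int j\<bar> = 1 then -1 else 0)"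

text \<open>The elements $k^\pm_{i,n}$ built from given elements $h_{im}$; the power series variable
  is $z^{\mp 1}$.\<close>

definition kcur :: "complex \<Rightarrow> (nat \<Rightarrow> int \<Rightarrow> alg) \<Rightarrow> sign \<Rightarrow> nat \<Rightarrow> int \<Rightarrow> alg"
  where "kcur q h \<sigma> i n =
    (if sg \<sigma> * n \<ge> 0 then
       kv \<sigma> i *
       fps_nth (fexp (Abs_fps (\<lambda>l. if l = 0 then 0
          else sc (of_int (sg \<sigma>) * (q - inverse q)) * h i (sg \<sigma> * int l)))) (nat \<bar>n\<bar>)
     else 0)"

definition rels_units :: "nat \<Rightarrow> alg set"
  where "rels_units N =
    {kv Pl i * kv Mi i - 1 | i. 1 \<le> i \<and> i \<le> N}
    \<union> {kv Mi i * kv Pl i - 1 | i. 1 \<le> i \<and> i \<le> N}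
    \<union> {var (Qc Pl) * var (Qc Mi) - 1, var (Qc Mi) * var (Qc Pl) - 1}"

definition rels_central :: "gen set \<Rightarrow> alg set"
  where "rels_central G = {comm (var (Qc Pl)) (var g) | g. g \<in> G}"

definition rels_R1 :: "nat \<Rightarrow> complex \<Rightarrow> alg set"
  where "rels_R1 N q =
    {(xv \<sigma> i (m + 1) * xv \<sigma> j n - sc (q powi (sg \<sigma> * cartan i j)) * xv \<sigma> j n * xv \<sigma> i (m + 1))
      - (sc (q powi (sg \<sigma> * cartan i j)) * xv \<sigma> i m * xv \<sigma> j (n + 1) - xv \<sigma> j (n + 1) * xv \<sigma> i m)
      | \<sigma> i j m n. i \<in> {1..N - 1} \<and> j \<in> {1..N - 1}}"

definition rels_R2 :: "nat \<Rightarrow> alg set"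
  where "rels_R2 N =
    {comm (xv \<sigma> i m) (xv \<sigma> j n)
      | \<sigma> i j m n. i \<in> {1..N - 1} \<and> j \<in> {1..N - 1} \<and> \<bar>int i - int j\<bar> > 1}"

definition rels_R3 :: "nat \<Rightarrow> complex \<Rightarrow> (nat \<Rightarrow> int \<Rightarrow> alg) \<Rightarrow> alg set"
  where "rels_R3 N q h =
    {comm (xv Pl i m) (xv Mi j n)
      - (if i = j then sc (1 / (q - inverse q)) *
           (kcur q h Pl i (m + n) * cpow (m - n) - kcur q h Mi i (m + n) * cpow (n - m)) else 0)
      | i j m n. i \<in> {1..N - 1} \<and> j \<in> {1..N - 1}}"

definition serre :: "complex \<Rightarrow> sign \<Rightarrow> nat \<Rightarrow> nat \<Rightarrow> int \<Rightarrow> int \<Rightarrow> int \<Rightarrow> alg"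
  where "serre q \<sigma> i j m1 m2 n =
    xv \<sigma> i m1 * xv \<sigma> i m2 * xv \<sigma> j n
    - sc (q + inverse q) * xv \<sigma> i m1 * xv \<sigma> j n * xv \<sigma> i m2
    + xv \<sigma> j n * xv \<sigma> i m1 * xv \<sigma> i m2"

definition rels_R4 :: "nat \<Rightarrow> complex \<Rightarrow> alg set"
  where "rels_R4 N q =
    {serre q \<sigma> i j m1 m2 n + serre q \<sigma> i j m2 m1 n
      | \<sigma> i j m1 m2 n. i \<in> {1..N - 1} \<and> j \<in> {1..N - 1} \<and> \<bar>int i - int j\<bar> = 1}"

definition common_rels :: "nat \<Rightarrow> complex \<Rightarrow> gen set \<Rightarrow> (nat \<Rightarrow> int \<Rightarrow> alg) \<Rightarrow> alg set"
  where "common_rels N q G h = rels_units N \<union> rels_central G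
    \<union> rels_R1 N q \<union> rels_R2 N \<union> rels_R3 N q h \<union> rels_R4 N q"


section \<open>The quantum affine algebra of $\mathfrak{gl}_N$\<close>

text \<open>Here and below \<open>s\<close> is the fixed square root $q^{1/2}$.\<close>

definition h_eps :: "complex \<Rightarrow> nat \<Rightarrow> int \<Rightarrow> alg"
  where "h_eps s i m = sc (s powi \<bar>m\<bar>) * ep i m - sc (s powi (- \<bar>m\<bar>)) * ep (i + 1) m"

definition eps_rels :: "nat \<Rightarrow> complex \<Rightarrow> complex \<Rightarrow> alg set"
  where "eps_rels N q s =
    {comm (ep i m) (ep j n)
      - (if i = j \<and> m = - n then sc (qint q m / of_int m) * qintc q m else 0)
      | i j m n. i \<in> {1..N} \<and> j \<in> {1..N} \<and> m \<noteq> 0 \<and> n \<noteq> 0}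
    \<union> {comm (ep i m) (xv \<sigma> j n)
      | \<sigma> i j m n. i \<in> {1..N} \<and> j \<in> {1..N - 1} \<and> m \<noteq> 0 \<and> j \<noteq> i \<and> j \<noteq> i - 1}
    \<union> {comm (ep i m) (xv \<sigma> i n)
      - sc (of_int (sg \<sigma>) * (qint q m / of_int m) * s powi \<bar>m\<bar>)
          * cpow (- (sg \<sigma> * \<bar>m\<bar>)) * xv \<sigma> i (m + n)
      | \<sigma> i m n. i \<in> {1..N - 1} \<and> m \<noteq> 0}
    \<union> {comm (ep i m) (xv \<sigma> (i - 1) n)
      + sc (of_int (sg \<sigma>) * (qint q m / of_int m) * s powi (- \<bar>m\<bar>))
          * cpow (- (sg \<sigma> * \<bar>m\<bar>)) * xv \<sigma> (i - 1) (m + n)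
      | \<sigma> i m n. i \<in> {2..N} \<and> m \<noteq> 0}
    \<union> common_rels N q (eps_gens N) (h_eps s)"

definition Uq_gl :: "nat \<Rightarrow> complex \<Rightarrow> complex \<Rightarrow> (complex, alg set) module"
  where "Uq_gl N q s = presented_alg (eps_gens N) (eps_rels N q s)"

definition U_cls :: "nat \<Rightarrow> complex \<Rightarrow> complex \<Rightarrow> alg \<Rightarrow> alg set"
  where "U_cls N q s = cls (eps_gens N) (eps_rels N q s)"

text \<open>Representatives of the elements $a_{im}$ of the quantum affine algebra; \<open>r k\<close> is the fixed
  square root of $1 + q^{2k} + \cdots + q^{2(N-1)k}$.\<close>

definition a_last :: "nat \<Rightarrow> complex \<Rightarrow> complex \<Rightarrow> (nat \<Rightarrow> complex) \<Rightarrow> int \<Rightarrow> alg"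
  where "a_last N q s r m =
    sc (q powi (int N * m) * s powi \<bar>m\<bar>) *
      (sc (of_int \<bar>m\<bar> / of_int m / r (nat \<bar>m\<bar>))
         * (\<Sum>l=1..N. sc (q powi ((int l - 1) * \<bar>m\<bar>)) * ep l m)
       + ep N m)"

definition a_elt :: "nat \<Rightarrow> complex \<Rightarrow> complex \<Rightarrow> (nat \<Rightarrow> complex) \<Rightarrow> nat \<Rightarrow> int \<Rightarrow> alg"
  where "a_elt N q s r i m = (if i = N then a_last N q s r m else
    (\<Sum>j=i..N - 1. sc (q powi (int j * m)) * h_eps s j m) + a_last N q s r m)"


section \<open>The second presentation\<close>

definition h_a :: "complex \<Rightarrow> nat \<Rightarrow> int \<Rightarrow> alg"
  where "h_a q i m = sc (q powi (- (int i * m))) * (av i m - av (i + 1) m)"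

definition a_rels :: "nat \<Rightarrow> complex \<Rightarrow> alg set"
  where "a_rels N q =
    {comm (av i m) (av i n) | i m n. i \<in> {1..N} \<and> m \<noteq> 0 \<and> n \<noteq> 0}
    \<union> {comm (av i m) (av j n)
      + (if m = - n then sc (qint q m / of_int m * q powi m) * qintc q m else 0)
      | i j m n. i \<in> {1..N} \<and> j \<in> {1..N} \<and> i > j \<and> m \<noteq> 0 \<and> n \<noteq> 0}
    \<union> {comm (av i m) (xv \<sigma> j n)
      | \<sigma> i j m n. i \<in> {1..N} \<and> j \<in> {1..N - 1} \<and> m \<noteq> 0 \<and> j \<noteq> i \<and> j \<noteq> i - 1}
    \<union> {comm (av i m) (xv \<sigma> i n)
      - sc (of_int (sg \<sigma>) * (qint q m / of_int m) * q powi ((int i - 1) * m))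
          * cpow (- (sg \<sigma> * \<bar>m\<bar>)) * xv \<sigma> i (m + n)
      | \<sigma> i m n. i \<in> {1..N - 1} \<and> m \<noteq> 0}
    \<union> {comm (av (i + 1) m) (xv \<sigma> i n)
      + sc (of_int (sg \<sigma>) * (qint q m / of_int m) * q powi ((int i + 1) * m))
          * cpow (- (sg \<sigma> * \<bar>m\<bar>)) * xv \<sigma> i (m + n)
      | \<sigma> i m n. i \<in> {1..N - 1} \<and> m \<noteq> 0}
    \<union> common_rels N q (a_gens N) (h_a q)"

definition a_alg :: "nat \<Rightarrow> complex \<Rightarrow> (complex, alg set) module"
  where "a_alg N q = presented_alg (a_gens N) (a_rels N q)"

definition a_cls :: "nat \<Rightarrow> complex \<Rightarrow> alg \<Rightarrow> alg set"
  where "a_cls N q = cls (a_gens N) (a_rels N q)"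

end

theory Submission
  imports Defs "Jordan_Normal_Form.Determinant"
begin

text \<open>For each \<open>m\<close> the elements $a_{im}$ are the images of the $\epsilon_{lm}$ under a matrix
  $A(m)$, and apart from (R3) the relations on these generators are linear in each of them. With
  $g_{ij}(m) = 0, -q^m, -q^{-m}$ for $i = j$, $i > j$, $i < j$, the relations among the $a_{im}$
  amount to $A(m) A(-m)^T = g(m)$, and those with $x^\pm_{jn}$ to $A(m)$ carrying one coefficient
  vector to the other. Since $A(m)$ is invertible, both identities can be read backwards, so
  the substitutions given by $A(m)$ and $A(m)^{-1}$ map each ideal of relations into the
  other. The remaining relations correspond literally, because
  $q^{-im}(a_{im} - a_{i+1,m}) = h_{im}$. A vector in the kernel of $A(m)$ must be proportional to
  $(q^{(l-1)|m|})_l$ by the differences of consecutive rows, and the last row then forces it to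
  vanish because $1 + q^{2|m|} + \cdots + q^{2(N-2)|m|} \neq 0$.\<close>

section \<open>Substitution in free algebras\<close>

text \<open>The shape of a_{Nm} is what makes A(m) A(-m)^T = g(m) hold. The vector w with entries
  w_l = q^{(l-1)|m|} is orthogonal to the coefficient vector of every h_{jm}, which is q^{|m|/2} at
  j and -q^{-|m|/2} at j + 1. Adding a multiple of w to all rows therefore leaves the commutators
  with x_{jn} unchanged. The square root normalises w to length 1. Since |m|/m is odd in m, the
  multiples of w in the rows for m and -m pair to the constant -q^{|m|}, while the mixed products
  cancel. This constant removes the diagonal, because without it each row for m would pair with the
  corresponding row for -m to q^{|m|}.

  The relation (R3) is not linear in h_{im}. It is harmless because the two versions of h_{im}
  correspond already in the free algebras, before any relation is imposed.\<close>

lemma sc_0 [simp]: "sc 0 = 0" by (simp add: sc_def)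
lemma sc_1 [simp]: "sc 1 = 1" by (simp add: sc_def)
lemma sc_add: "sc (a + b) = sc a + sc b" by (simp add: sc_def single_add)
lemma sc_mult: "sc (a * b) = sc a * sc b" by (simp add: sc_def mult_single)
lemma sc_uminus: "sc (- a) = - sc a" by (simp add: sc_def single_uminus)

lemma sc_mult_single: "sc c * Poly_Mapping.single w d = Poly_Mapping.single w (c * d)"
  by (simp add: sc_def mult_single)

text \<open>An update at a new key is the addition of a monomial, so additive statements need only
  be checked on monomials.\<close>

lemma falg_induct [case_names zero single add]:
  fixes p :: "'g falg"
  assumes "P 0" "\<And>w c. P (Poly_Mapping.single w c)" "\<And>p q. P p \<Longrightarrow> P q \<Longrightarrow> P (p + q)"
  shows "P p"
proof (induction p rule: update_induct)
  case const
  then show ?case by (rule assms)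
next
  case (update f a b)
  have "Poly_Mapping.update a b f = f + Poly_Mapping.single a b"
    using update(1) by (intro poly_mapping_eqI)
      (auto simp: lookup_update lookup_add lookup_single when_def in_keys_iff)
  then show ?case using update assms by metis
qed

lemma sc_commute: "sc c * p = p * sc c"
  by (induction p rule: falg_induct) (simp_all add: sc_def mult_single algebra_simps)

lemma sc_left_commute: "p * (sc c * r) = sc c * (p * r)"
  by (simp add: sc_commute[of c p] flip: mult.assoc)

text \<open>The homomorphism given by the universal property of the free algebra. It is total on the
  type, so that one function serves every set of generators; \<open>gen\<close> contains the
  generators of both presentations.\<close>

definition falg_subst :: "('g \<Rightarrow> 'h falg) \<Rightarrow> 'g falg \<Rightarrow> 'h falg"
  where "falg_subst f p =
    (\<Sum>w\<in>Poly_Mapping.keys p. sc (Poly_Mapping.lookup p w) * prod_list (map f (letters w)))"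

text \<open>Cancellation can make the support of \<open>p + q\<close> smaller than the union of the
  two supports. A common finite index set makes the sums for different elements comparable.\<close>

lemma falg_subst_superset:
  assumes "finite A" "Poly_Mapping.keys p \<subseteq> A"
  shows "falg_subst f p = (\<Sum>w\<in>A. sc (Poly_Mapping.lookup p w) * prod_list (map f (letters w)))"
  unfolding falg_subst_def using assms
  by (intro sum.mono_neutral_left) (auto simp: in_keys_iff)

lemma falg_subst_zero [simp]: "falg_subst f 0 = 0"
  by (simp add: falg_subst_def)

lemma falg_subst_single:
  "falg_subst f (Poly_Mapping.single w c) = sc c * prod_list (map f (letters w))"
  by (simp add: falg_subst_superset[of "{w}"])

lemma falg_subst_add: "falg_subst f (p + q) = falg_subst f p + falg_subst f q"
proof -
  let ?A = "Poly_Mapping.keys p \<union> Poly_Mapping.keys q"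
  have "finite ?A" "Poly_Mapping.keys (p + q) \<subseteq> ?A" using keys_add[of p q] by auto
  then show ?thesis
    by (simp add: falg_subst_superset[of ?A] lookup_add sc_add distrib_right sum.distrib)
qed

lemma falg_subst_mult: "falg_subst f (p * q) = falg_subst f p * falg_subst f q"
proof (induction p rule: falg_induct)
  case (single w c)
  show ?case
  proof (induction q rule: falg_induct)
    case (single w' d)
    let ?P = "\<lambda>w. prod_list (map f (letters w))"
    have "sc c * sc d * (?P w * ?P w') = sc c * ?P w * (sc d * ?P w')"
      using sc_commute[of d "?P w"] by (simp add: mult.assoc) (simp flip: mult.assoc)
    then show ?case
      by (simp only: mult_single falg_subst_single plus_fmon_def sc_mult fmon.sel map_append
          prod_list.append)
  qed (simp_all add: falg_subst_add distrib_left)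
qed (simp_all add: falg_subst_add distrib_right)

lemma falg_subst_sc [simp]: "falg_subst f (sc c) = sc c"
  unfolding sc_def[of c] by (simp add: falg_subst_single zero_fmon_def) (simp add: sc_def zero_fmon_def)

lemma falg_subst_one [simp]: "falg_subst f 1 = 1"
  using falg_subst_sc[of f 1] by simp

lemma falg_subst_var [simp]: "falg_subst f (var g) = f g"
  by (simp add: var_def falg_subst_single)

lemma falg_subst_uminus: "falg_subst f (- p) = - falg_subst f p"
  using falg_subst_add[of f p "- p"] by (simp add: minus_unique)

lemma falg_subst_diff: "falg_subst f (p - q) = falg_subst f p - falg_subst f q"
  using falg_subst_add[of f p "- q"] by (simp add: falg_subst_uminus)

lemma falg_subst_sum: "falg_subst f (sum g A) = (\<Sum>x\<in>A. falg_subst f (g x))"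
  by (induction A rule: infinite_finite_induct) (simp_all add: falg_subst_add)

lemma falg_subst_power: "falg_subst f (p ^ n) = falg_subst f p ^ n"
  by (induction n) (simp_all add: falg_subst_mult)

lemmas falg_subst_hom = falg_subst_add falg_subst_mult falg_subst_diff falg_subst_uminus
  falg_subst_sum falg_subst_power

lemma falg_subst_fps_power:
  "falg_subst f (fps_nth (F ^ i) n) = fps_nth (Abs_fps (\<lambda>n. falg_subst f (fps_nth F n)) ^ i) n"
  by (induction i arbitrary: n) (simp_all add: fps_mult_nth falg_subst_hom)

text \<open>Each coefficient of the exponential is a noncommutative polynomial, with scalar
  coefficients, in finitely many coefficients of \<open>F\<close>. An algebra homomorphism therefore
  acts coefficientwise.\<close>

lemma falg_subst_fexp:
  "falg_subst f (fps_nth (fexp F) n) = fps_nth (fexp (Abs_fps (\<lambda>n. falg_subst f (fps_nth F n)))) n"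
  by (simp add: fexp_def fps_compose_nth falg_subst_hom falg_subst_fps_power)

subsection \<open>The subalgebra on a set of generators\<close>

abbreviation fcar :: "'g set \<Rightarrow> 'g falg set"
  where "fcar G \<equiv> carrier (free_alg G)"

lemma fcar_iff: "p \<in> fcar G \<longleftrightarrow> (\<forall>w \<in> Poly_Mapping.keys p. set (letters w) \<subseteq> G)"
  by (simp add: free_alg_def)

lemma fcar_zero [simp]: "0 \<in> fcar G" by (simp add: fcar_iff)
lemma fcar_one [simp]: "1 \<in> fcar G" by (simp add: fcar_iff zero_fmon_def)
lemma fcar_sc [simp]: "sc c \<in> fcar G" by (simp add: fcar_iff sc_def zero_fmon_def)
lemma fcar_var [simp]: "var g \<in> fcar G \<longleftrightarrow> g \<in> G" by (simp add: fcar_iff var_def)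
lemma fcar_add: "p \<in> fcar G \<Longrightarrow> q \<in> fcar G \<Longrightarrow> p + q \<in> fcar G"
  using keys_add[of p q] unfolding fcar_iff by blast
lemma fcar_uminus: "p \<in> fcar G \<Longrightarrow> - p \<in> fcar G" by (simp add: fcar_iff)
lemma fcar_diff: "p \<in> fcar G \<Longrightarrow> q \<in> fcar G \<Longrightarrow> p - q \<in> fcar G"
  using fcar_add[of p G "- q"] by (simp add: fcar_uminus)
lemma fcar_mult: "p \<in> fcar G \<Longrightarrow> q \<in> fcar G \<Longrightarrow> p * q \<in> fcar G"
  using keys_mult[of p q] unfolding fcar_iff plus_fmon_def by fastforce
lemma fcar_sum: "(\<And>x. x \<in> A \<Longrightarrow> g x \<in> fcar G) \<Longrightarrow> sum g A \<in> fcar G"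
  by (induction A rule: infinite_finite_induct) (simp_all add: fcar_add)
lemma fcar_power: "p \<in> fcar G \<Longrightarrow> p ^ n \<in> fcar G"
  by (induction n) (simp_all add: fcar_mult)

lemma fcar_fps_power:
  "(\<And>n. fps_nth F n \<in> fcar G) \<Longrightarrow> fps_nth (F ^ i) n \<in> fcar G"
  by (induction i arbitrary: n) (auto simp: fps_mult_nth intro!: fcar_sum fcar_mult)

lemma fcar_fexp: "(\<And>n. fps_nth F n \<in> fcar G) \<Longrightarrow> fps_nth (fexp F) n \<in> fcar G"
  by (auto simp: fexp_def fps_compose_nth intro!: fcar_sum fcar_mult fcar_fps_power)

lemma fcar_prod_list: "(\<And>x. x \<in> set xs \<Longrightarrow> x \<in> fcar G) \<Longrightarrow> prod_list xs \<in> fcar G"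
  by (induction xs) (auto intro: fcar_mult)

lemma falg_subst_closed:
  assumes "p \<in> fcar G" "\<And>g. g \<in> G \<Longrightarrow> f g \<in> fcar H"
  shows "falg_subst f p \<in> fcar H"
  unfolding falg_subst_def using assms
  by (force simp: fcar_iff[of p] intro!: fcar_sum fcar_mult fcar_prod_list)

lemma falg_subst_cong:
  assumes "p \<in> fcar G" "\<And>g. g \<in> G \<Longrightarrow> f g = f' g"
  shows "falg_subst f p = falg_subst f' p"
proof -
  have "map f (letters w) = map f' (letters w)" if "w \<in> Poly_Mapping.keys p" for w
    using assms that by (force simp: fcar_iff)
  then show ?thesis by (simp add: falg_subst_def del: map_eq_conv cong: sum.cong)
qed

lemma falg_subst_falg_subst:
  "falg_subst f (falg_subst f' p) = falg_subst (\<lambda>g. falg_subst f (f' g)) p"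
proof -
  have "falg_subst f (prod_list (map f' ws)) = prod_list (map (\<lambda>g. falg_subst f (f' g)) ws)" for ws
    by (induction ws) (simp_all add: falg_subst_mult)
  then show ?thesis
    by (simp add: falg_subst_def[of f'] falg_subst_hom) (simp add: falg_subst_def)
qed

lemma falg_subst_id: "falg_subst var p = p"
proof (induction p rule: falg_induct)
  case (single w c)
  have "prod_list (map var ws) = Poly_Mapping.single (Word ws) 1" for ws :: "'a list"
    by (induction ws) (simp_all add: var_def mult_single plus_fmon_def flip: zero_fmon_def)
  then show ?case by (simp add: falg_subst_single sc_mult_single)
qed (simp_all add: falg_subst_add)

text \<open>The composite of the two substitutions is controlled only on \<open>G\<close>, so the
  conclusion is confined to the subalgebra generated by \<open>G\<close>.\<close>

lemma falg_subst_inverse: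
  assumes "p \<in> fcar G" "\<And>g. g \<in> G \<Longrightarrow> falg_subst f' (f g) = var g"
  shows "falg_subst f' (falg_subst f p) = p"
  using falg_subst_cong[OF assms(1), of "\<lambda>g. falg_subst f' (f g)" var] assms(2)
  by (simp add: falg_subst_falg_subst falg_subst_id)

lemma free_alg_simps [simp]:
  "x \<oplus>\<^bsub>free_alg G\<^esub> y = x + y" "x \<otimes>\<^bsub>free_alg G\<^esub> y = x * y"
  "\<zero>\<^bsub>free_alg G\<^esub> = 0" "\<one>\<^bsub>free_alg G\<^esub> = 1"
  "c \<odot>\<^bsub>free_alg G\<^esub> x = sc c * x"
  by (simp_all add: free_alg_def)

lemma ring_free_alg: "ring (free_alg G)"
proof (rule ringI)
  show "abelian_group (free_alg G)"
  proof (rule abelian_groupI)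
    fix x assume "x \<in> fcar G"
    then show "\<exists>y\<in>fcar G. y \<oplus>\<^bsub>free_alg G\<^esub> x = \<zero>\<^bsub>free_alg G\<^esub>"
      by (intro bexI[of _ "- x"]) (simp_all add: fcar_uminus)
  qed (simp_all add: fcar_add add_ac)
  show "monoid (free_alg G)"
    by (rule monoidI) (simp_all add: fcar_mult mult.assoc)
qed (simp_all add: distrib_left distrib_right)

section \<open>Isomorphisms of presented algebras\<close>

lemma quot_alg_simps [simp]:
  "carrier (quot_alg A I) = carrier (A Quot I)"
  "Y \<otimes>\<^bsub>quot_alg A I\<^esub> Z = Y \<otimes>\<^bsub>A Quot I\<^esub> Z" "\<one>\<^bsub>quot_alg A I\<^esub> = \<one>\<^bsub>A Quot I\<^esub>"
  "Y \<oplus>\<^bsub>quot_alg A I\<^esub> Z = Y \<oplus>\<^bsub>A Quot I\<^esub> Z"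
  "c \<odot>\<^bsub>quot_alg A I\<^esub> Y = (\<Union>x\<in>Y. I +>\<^bsub>A\<^esub> (c \<odot>\<^bsub>A\<^esub> x))"
  by (simp_all add: quot_alg_def ring.defs module.defs)

lemma ideal_rel_ideal: "R \<subseteq> fcar G \<Longrightarrow> ideal (rel_ideal G R) (free_alg G)"
  unfolding rel_ideal_def by (rule ring.genideal_ideal[OF ring_free_alg])

lemma rel_ideal_self: "R \<subseteq> fcar G \<Longrightarrow> R \<subseteq> rel_ideal G R"
  unfolding rel_ideal_def by (rule ring.genideal_self[OF ring_free_alg])

text \<open>The scalar action of \<open>quot_alg\<close> is a union over all representatives of a
  coset. An ideal absorbs \<open>sc c\<close>, so all cosets in this union coincide.\<close>

lemma ideal_free_alg_smult:
  assumes "ideal I (free_alg G)" "p \<in> fcar G"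
  shows "(\<Union>x\<in>I +>\<^bsub>free_alg G\<^esub> p. I +>\<^bsub>free_alg G\<^esub> (sc c * x)) = I +>\<^bsub>free_alg G\<^esub> (sc c * p)"
proof -
  interpret ideal I "free_alg G" by fact
  have "I +>\<^bsub>free_alg G\<^esub> (sc c * x) = I +>\<^bsub>free_alg G\<^esub> (sc c * p)"
    if x: "x \<in> I +>\<^bsub>free_alg G\<^esub> p" for x
  proof -
    obtain i where i: "i \<in> I" "x = i + p"
      using x by (auto simp: a_r_coset_def')
    have "sc c * i \<in> I"
      using I_l_closed[OF i(1), of "sc c"] by simp
    then have "sc c * x \<in> I +>\<^bsub>free_alg G\<^esub> (sc c * p)"
      by (auto simp: a_r_coset_def' i(2) distrib_left)
    then show ?thesis
      using a_repr_independence'[of "sc c * x" "sc c * p"] assms(2) by (simp add: fcar_mult)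
  qed
  \<comment> \<open>The union has to be nonempty as well.\<close>
  moreover have "p \<in> I +>\<^bsub>free_alg G\<^esub> p"
    using a_rcos_self assms(2) by simp
  ultimately show ?thesis by blast
qed

lemma ring_hom_falg_subst:
  assumes "\<And>g. g \<in> G \<Longrightarrow> f g \<in> fcar H"
  shows "falg_subst f \<in> Ring.ring_hom (free_alg G) (free_alg H)"
  by (rule ring_hom_memI) (auto simp: falg_subst_hom intro: falg_subst_closed assms)

text \<open>Substitution followed by projection serves twice: its kernel is an ideal, which
  transports ideals of relations, and the first isomorphism theorem is applied to it.\<close>

lemma ring_hom_falg_subst_quot:
  assumes J: "ideal J (free_alg H)" and f: "\<And>g. g \<in> G \<Longrightarrow> f g \<in> fcar H"
  defines "h \<equiv> \<lambda>p. J +>\<^bsub>free_alg H\<^esub> falg_subst f p"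
  shows "ring_hom_ring (free_alg G) (free_alg H Quot J) h"
    and "a_kernel (free_alg G) (free_alg H Quot J) h = {p \<in> fcar G. falg_subst f p \<in> J}"
proof -
  interpret J: ideal J "free_alg H" by (rule J)
  have "h \<in> Ring.ring_hom (free_alg G) (free_alg H Quot J)"
    using ring_hom_trans[OF ring_hom_falg_subst[of G f H, OF f] J.rcos_ring_hom]
    by (simp add: h_def comp_def)
  then show "ring_hom_ring (free_alg G) (free_alg H Quot J) h"
    by (intro ring_hom_ringI2 ring_free_alg J.quotient_is_ring)
  have "h p = J \<longleftrightarrow> falg_subst f p \<in> J" if "p \<in> fcar G" for p
    using J.rcos_const_imp_mem[of "falg_subst f p"] J.a_rcos_const[of "falg_subst f p"]
      falg_subst_closed[OF that f]
    by (auto simp: h_def)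
  then show "a_kernel (free_alg G) (free_alg H Quot J) h = {p \<in> fcar G. falg_subst f p \<in> J}"
    by (auto simp: a_kernel_def' FactRing_def)
qed

text \<open>An ideal is the kernel of the projection modulo it, so a substitution sending the relations
  into the other ideal sends the whole ideal there.\<close>

lemma falg_subst_rel_ideal:
  assumes J: "ideal J (free_alg H)" and f: "\<And>g. g \<in> G \<Longrightarrow> f g \<in> fcar H"
    and R: "R \<subseteq> fcar G" "\<And>p. p \<in> R \<Longrightarrow> falg_subst f p \<in> J"
    and p: "p \<in> rel_ideal G R"
  shows "falg_subst f p \<in> J"
proof -
  note hom = ring_hom_falg_subst_quot[of J H G f, OF J f]
  have "ideal {p \<in> fcar G. falg_subst f p \<in> J} (free_alg G)"
    using ring_hom_ring.kernel_is_ideal[OF hom(1)] hom(2) by simp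
  moreover have "R \<subseteq> {p \<in> fcar G. falg_subst f p \<in> J}"
    using R by auto
  ultimately show ?thesis
    using ring.genideal_minimal[OF ring_free_alg] p unfolding rel_ideal_def by blast
qed

text \<open>The first isomorphism theorem for substitution followed by projection. The inverse
  substitution \<open>f'\<close> plays two roles: it brings elements sent into \<open>J\<close> back
  into \<open>I\<close>, which makes the kernel exactly \<open>I\<close>, and it provides
  preimages.\<close>

theorem presented_alg_iso:
  assumes R: "R \<subseteq> fcar G" and S: "S \<subseteq> fcar H"
    and f: "\<And>g. g \<in> G \<Longrightarrow> f g \<in> fcar H" and f': "\<And>g. g \<in> H \<Longrightarrow> f' g \<in> fcar G"
    and fR: "\<And>p. p \<in> R \<Longrightarrow> falg_subst f p \<in> rel_ideal H S"
    and f'S: "\<And>p. p \<in> S \<Longrightarrow> falg_subst f' p \<in> rel_ideal G R"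
    and f'f: "\<And>g. g \<in> G \<Longrightarrow> falg_subst f' (f g) = var g"
    and ff': "\<And>g. g \<in> H \<Longrightarrow> falg_subst f (f' g) = var g"
  shows "\<exists>\<phi> \<in> alg_iso (presented_alg G R) (presented_alg H S).
    \<forall>p \<in> fcar G. \<phi> (cls G R p) = cls H S (falg_subst f p)"
proof -
  define I where "I = rel_ideal G R"
  define J where "J = rel_ideal H S"
  define h where "h = (\<lambda>p. J +>\<^bsub>free_alg H\<^esub> falg_subst f p)"
  define \<phi> where "\<phi> = (\<lambda>Y. the_elem (h ` Y))"
  let ?Q = "free_alg G Quot I" and ?Q' = "free_alg H Quot J"
  have I: "ideal I (free_alg G)" and J: "ideal J (free_alg H)"
    by (simp_all add: I_def J_def ideal_rel_ideal R S)
  interpret I: ideal I "free_alg G" by (rule I)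
  interpret h: ring_hom_ring "free_alg G" ?Q' h
    unfolding h_def by (rule ring_hom_falg_subst_quot(1)[OF J f])
  have "p \<in> I \<longleftrightarrow> falg_subst f p \<in> J" if p: "p \<in> fcar G" for p
  proof
    show "falg_subst f p \<in> J" if "p \<in> I"
      using falg_subst_rel_ideal[OF J f R] fR that by (simp add: I_def J_def)
    assume "falg_subst f p \<in> J"
    then have "falg_subst f' (falg_subst f p) \<in> I"
      using falg_subst_rel_ideal[OF I f' S] f'S by (simp add: I_def J_def)
    then show "p \<in> I"
      by (simp add: falg_subst_inverse[OF p f'f])
  qed
  then have "{p \<in> fcar G. falg_subst f p \<in> J} = I"
    using I.Icarr by blast
  then have ker: "a_kernel (free_alg G) ?Q' h = I"
    using ring_hom_falg_subst_quot(2)[of J H G f, OF J f] by (simp add: h_def)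
  have "h ` fcar G = carrier ?Q'"
  proof
    show "h ` fcar G \<subseteq> carrier ?Q'" using h.hom_closed by auto
    show "carrier ?Q' \<subseteq> h ` fcar G"
    proof
      fix Y assume "Y \<in> carrier ?Q'"
      then obtain p where p: "p \<in> fcar H" "Y = J +>\<^bsub>free_alg H\<^esub> p"
        by (auto simp: FactRing_def A_RCOSETS_def')
      then have "Y = h (falg_subst f' p)"
        by (simp add: h_def falg_subst_inverse[OF _ ff'])
      moreover have "falg_subst f' p \<in> fcar G"
        by (rule falg_subst_closed[OF p(1) f'])
      ultimately show "Y \<in> h ` fcar G" by blast
    qed
  qed
  then have iso: "\<phi> \<in> ring_iso ?Q ?Q'"
    using h.FactRing_iso_set unfolding ker \<phi>_def by simp
  have \<phi>: "\<phi> (I +>\<^bsub>free_alg G\<^esub> p) = J +>\<^bsub>free_alg H\<^esub> falg_subst f p" if "p \<in> fcar G" for p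
    using h.the_elem_simp[OF that, unfolded ker] by (simp add: \<phi>_def h_def)
  \<comment> \<open>So far \<open>\<phi>\<close> is only a ring isomorphism. Compatibility with
    scalars is checked on a representative.\<close>
  have "\<phi> (\<Union>x\<in>Y. I +>\<^bsub>free_alg G\<^esub> (sc c * x)) = (\<Union>x\<in>\<phi> Y. J +>\<^bsub>free_alg H\<^esub> (sc c * x))"
    if Y: "Y \<in> carrier ?Q" for c Y
  proof -
    obtain p where p: "p \<in> fcar G" "Y = I +>\<^bsub>free_alg G\<^esub> p"
      using Y by (auto simp: FactRing_def A_RCOSETS_def')
    show ?thesis
      using p falg_subst_closed[of p G f, OF p(1) f]
      by (simp add: ideal_free_alg_smult[OF I] ideal_free_alg_smult[OF J] \<phi> fcar_mult falg_subst_mult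
          flip: h_def)
  qed
  then have "\<phi> \<in> alg_iso (presented_alg G R) (presented_alg H S)"
    using iso
    by (auto simp: alg_iso_def presented_alg_def ring_iso_def Ring.ring_hom_def simp flip: I_def J_def)
  then show ?thesis
    using \<phi> by (intro bexI[of _ \<phi>]) (auto simp: cls_def I_def J_def)
qed

section \<open>The change of generators of the Heisenberg part\<close>

text \<open>A square matrix over a field with trivial kernel has nonzero determinant and hence a
  two-sided inverse. The coefficients are indexed from 1 and the matrices from 0, which explains the
  shifts.\<close>

lemma inverse_coefficients:
  fixes a :: "nat \<Rightarrow> nat \<Rightarrow> 'a::field"
  assumes inj: "\<And>v. (\<And>i. i \<in> {1..N} \<Longrightarrow> (\<Sum>l=1..N. a i l * v l) = 0) \<Longrightarrow> (\<And>l. l \<in> {1..N} \<Longrightarrow> v l = 0)"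
  shows "\<exists>b. \<forall>i \<in> {1..N}. \<forall>k \<in> {1..N}.
    (\<Sum>l=1..N. a i l * b l k) = (if i = k then 1 else 0) \<and>
    (\<Sum>l=1..N. b i l * a l k) = (if i = k then 1 else 0)"
proof -
  define A where "A = mat N N (\<lambda>(i, j). a (Suc i) (Suc j))"
  have A: "A \<in> carrier_mat N N" by (simp add: A_def)
  have shift: "(\<Sum>l=1..N. f l) = (\<Sum>l=0..<N. f (Suc l))" for f :: "nat \<Rightarrow> 'a"
    by (simp add: sum.shift_bounds_Suc_ivl[symmetric] atLeastLessThanSuc_atLeastAtMost)
  have "det A \<noteq> 0"
  proof
    assume "det A = 0"
    then obtain v where v: "v \<in> carrier_vec N" "v \<noteq> 0\<^sub>v N" "A *\<^sub>v v = 0\<^sub>v N"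
      using det_0_iff_vec_prod_zero_field[OF A] by auto
    have "(\<Sum>l=1..N. a i l * vec_index v (l - 1)) = 0" if "i \<in> {1..N}" for i
    proof -
      have "vec_index (A *\<^sub>v v) (i - 1) = 0" using v(3) that by auto
      then show ?thesis using v(1) that
        by (cases i) (simp_all add: A_def scalar_prod_def shift[simplified])
    qed
    then have "vec_index v (l - 1) = 0" if "l \<in> {1..N}" for l
      using inj[of "\<lambda>l. vec_index v (l - 1)"] that by blast
    then have "vec_index v l = 0" if "l < N" for l
      using that by (metis Suc_leI atLeastAtMost_iff diff_Suc_1 le_add1 plus_1_eq_Suc)
    then show False using v(1,2) by auto
  qed
  then have "A \<in> Units (ring_mat TYPE('a) N ())"
    by (rule det_non_zero_imp_unit[OF A])
  then obtain B where B: "B \<in> carrier_mat N N" "A * B = 1\<^sub>m N" "B * A = 1\<^sub>m N"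
    by (auto simp: Units_def ring_mat_def)
  have "(\<Sum>l=1..N. a i l * B $$ (l - 1, k - 1)) = (if i = k then 1 else 0) \<and>
      (\<Sum>l=1..N. B $$ (i - 1, l - 1) * a l k) = (if i = k then 1 else 0)"
    if ik: "i \<in> {1..N}" "k \<in> {1..N}" for i k
  proof -
    obtain i' k' where i': "i = Suc i'" "k = Suc k'" "i' < N" "k' < N"
      using ik by (cases i; cases k) auto
    have "(A * B) $$ (i', k') = (\<Sum>l=0..<N. a i (Suc l) * B $$ (l, k'))"
      "(B * A) $$ (i', k') = (\<Sum>l=0..<N. B $$ (i', l) * a (Suc l) k)"
      using i'(3,4) B(1) unfolding i'(1,2) by (simp_all add: A_def scalar_prod_def)
    moreover have "(A * B) $$ (i', k') = (if i = k then 1 else 0)"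
      "(B * A) $$ (i', k') = (if i = k then 1 else 0)"
      unfolding B(2,3) i'(1,2) using i'(3,4) by auto
    ultimately show ?thesis
      unfolding shift by (simp only: i'(1,2) diff_Suc_1)
  qed
  then show ?thesis
    by (intro exI[of _ "\<lambda>i k. B $$ (i - 1, k - 1)"] ballI)
qed

section \<open>Coefficient matrices of the change of generators\<close>

definition a_gram :: "complex \<Rightarrow> int \<Rightarrow> nat \<Rightarrow> nat \<Rightarrow> complex"
  where "a_gram q m i j = (if i = j then 0 else if i > j then - (q powi m) else - (q powi (- m)))"

text \<open>Column \<open>j\<close> lists the coefficients of the commutators with x_{jn}, with
  zeros for the vanishing ones. It is also the coefficient vector of h_{jm}.\<close>

definition eps_x_coeff :: "complex \<Rightarrow> int \<Rightarrow> nat \<Rightarrow> nat \<Rightarrow> complex"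
  where "eps_x_coeff s m l j =
    (if l = j then s powi \<bar>m\<bar> else if l = j + 1 then - (s powi (- \<bar>m\<bar>)) else 0)"

definition a_x_coeff :: "complex \<Rightarrow> int \<Rightarrow> nat \<Rightarrow> nat \<Rightarrow> complex"
  where "a_x_coeff q m i j = (if i = j then q powi ((int i - 1) * m)
    else if i = j + 1 then - (q powi ((int j + 1) * m)) else 0)"

text \<open>The generator epsilon_{lm} occurs in h_{jm} for j = l and j = l - 1, whence the two
  conditionals. The separate summand epsilon_{Nm} of a_{Nm} supplies the case l = N of the first
  one, so one formula covers the whole matrix. The last term is a rank one part common to all
  rows.\<close>

definition a_coeff ::
    "nat \<Rightarrow> complex \<Rightarrow> complex \<Rightarrow> (nat \<Rightarrow> complex) \<Rightarrow> int \<Rightarrow> nat \<Rightarrow> nat \<Rightarrow> complex"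
  where "a_coeff N q s r m i l =
    (if i \<le> l then q powi (int l * m) * s powi \<bar>m\<bar> else 0)
    - (if i < l then q powi ((int l - 1) * m) * s powi (- \<bar>m\<bar>) else 0)
    + q powi (int N * m) * s powi \<bar>m\<bar> * (of_int \<bar>m\<bar> / of_int m / r (nat \<bar>m\<bar>))
        * q powi ((int l - 1) * \<bar>m\<bar>)"

lemma a_elt_step:
  assumes "i < N"
  shows "a_elt N q s r i m = sc (q powi (int i * m)) * h_eps s i m + a_elt N q s r (i + 1) m"
proof (cases "i + 1 = N")
  case True
  then have "N = Suc i" by simp
  then show ?thesis by (simp add: a_elt_def)
next
  case False
  then have "(\<Sum>j=i..N - 1. f j) = f i + (\<Sum>j=i + 1..N - 1. f j)" for f :: "nat \<Rightarrow> alg"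
    using assms by (subst sum.atLeast_Suc_atMost) auto
  moreover have "i \<noteq> N" using assms by simp
  ultimately show ?thesis using False by (simp only: a_elt_def if_False add.assoc)
qed

lemma a_coeff_step:
  "a_coeff N q s r m i l - a_coeff N q s r m (i + 1) l =
    (if l = i then q powi (int i * m) * s powi \<bar>m\<bar> else 0)
    - (if l = i + 1 then q powi (int i * m) * s powi (- \<bar>m\<bar>) else 0)"
  by (auto simp: a_coeff_def not_le)

lemma sum_if_lin:
  fixes f :: "nat \<Rightarrow> 'a falg"
  shows "i \<in> {1..N} \<Longrightarrow> (\<Sum>l=1..N. sc (if l = i then c l else 0) * f l) = sc (c i) * f i"
  by (simp add: if_distrib[of sc] if_distrib[of "\<lambda>x. x * _"] sum.delta cong: if_cong)

text \<open>Downward induction from row N: for the elements as for the coefficients, consecutive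
  rows differ by q^{im} h_{im}.\<close>

lemma a_elt_eq_sum:
  assumes "i \<in> {1..N}"
  shows "a_elt N q s r i m = (\<Sum>l=1..N. sc (a_coeff N q s r m i l) * ep l m)"
proof -
  have "i \<le> N" "1 \<le> i" using assms by auto
  then show ?thesis
  proof (induction rule: inc_induct)
    case base
    have eq: "a_coeff N q s r m N l =
        (if l = N then q powi (int l * m) * s powi \<bar>m\<bar> else 0) + q powi (int N * m) * s powi \<bar>m\<bar> * (of_int \<bar>m\<bar> / of_int m / r (nat \<bar>m\<bar>))
        * q powi ((int l - 1) * \<bar>m\<bar>)" if "l \<in> {1..N}" for l
      using that by (simp add: a_coeff_def)
    have "(\<Sum>l=1..N. sc (a_coeff N q s r m N l) * ep l m)
      = (\<Sum>l=1..N. sc (if l = N then q powi (int l * m) * s powi \<bar>m\<bar> else 0) * ep l m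
          + sc (q powi (int N * m) * s powi \<bar>m\<bar>) * (sc (of_int \<bar>m\<bar> / of_int m / r (nat \<bar>m\<bar>))
            * (sc (q powi ((int l - 1) * \<bar>m\<bar>)) * ep l m)))"
      by (intro sum.cong refl) (simp only: eq sc_add sc_mult distrib_right mult.assoc)
    also have "\<dots> = a_last N q s r m"
      using base by (simp add: sum.distrib sum_if_lin[unfolded One_nat_def] a_last_def distrib_left sum_distrib_left)
    finally show ?case by (simp add: a_elt_def)
  next
    case (step i)
    have eq: "a_coeff N q s r m i l = (if l = i then q powi (int i * m) * s powi \<bar>m\<bar> else 0)
      - (if l = i + 1 then q powi (int i * m) * s powi (- \<bar>m\<bar>) else 0)
      + a_coeff N q s r m (i + 1) l" for l
      using a_coeff_step[of N q s r m i l] by (simp only: diff_eq_eq)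
    have "(\<Sum>l=1..N. sc (a_coeff N q s r m i l) * ep l m)
      = (\<Sum>l=1..N. sc (if l = i then q powi (int i * m) * s powi \<bar>m\<bar> else 0) * ep l m)
      - (\<Sum>l=1..N. sc (if l = i + 1 then q powi (int i * m) * s powi (- \<bar>m\<bar>) else 0) * ep l m)
      + a_elt N q s r (i + 1) m"
      using step by (subst eq) (simp add: sc_add diff_conv_add_uminus sc_uminus distrib_right
          sum.distrib sum_negf del: add_uminus_conv_diff)
    also have "\<dots> = sc (q powi (int i * m)) * h_eps s i m + a_elt N q s r (i + 1) m"
      using step(1,2,4) by (simp add: sum_if_lin[unfolded One_nat_def] h_eps_def sc_mult right_diff_distrib mult.assoc)
    finally show ?case using a_elt_step[OF step(2)] by simp
  qed
qed

section \<open>Identities satisfied by the matrices A(m)\<close>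

locale gl_params =
  fixes N :: nat and q s :: complex and r :: "nat \<Rightarrow> complex"
  assumes N: "N \<ge> 2" and gen: "generic q" and sq: "s ^ 2 = q"
    and r: "\<And>k. k \<ge> 1 \<Longrightarrow> (r k) ^ 2 = (\<Sum>l<N. q ^ (2 * l * k))"
begin

lemma q0: "q \<noteq> 0" and s0: "s \<noteq> 0"
  using gen sq by (auto simp: generic_def)

text \<open>In the closed form of this geometric sum neither q^{2kn} - 1 nor q^{2k} - 1 vanishes.
  The length is left free because it is N for the square root and N - 1 for the kernel.\<close>

lemma sum_q_nonzero:
  assumes "k \<ge> 1" "n \<ge> 1"
  shows "(\<Sum>l<n. q ^ (2 * l * k)) \<noteq> 0"
proof -
  have 1: "q ^ (2 * k) \<noteq> 1" "q ^ (2 * k * n) \<noteq> 1"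
    using gen assms by (auto simp: generic_def)
  have "(\<Sum>l<n. q ^ (2 * l * k)) = (\<Sum>l<n. (q ^ (2 * k)) ^ l)"
    by (simp add: mult_ac flip: power_mult)
  also have "\<dots> = (q ^ (2 * k * n) - 1) / (q ^ (2 * k) - 1)"
    using 1 by (simp add: geometric_sum power_mult)
  finally show ?thesis using 1 by simp
qed

lemma r_nonzero: "k \<ge> 1 \<Longrightarrow> r k \<noteq> 0"
  using r[of k] sum_q_nonzero[of k N] N by force

abbreviation "ac \<equiv> a_coeff N q s r"

lemma s_powi_square: "s powi k * s powi k = q powi k"
  by (simp add: sq[symmetric] power2_eq_square power_int_mult_distrib)

text \<open>The rank one part drops out by orthogonality to h_{jm}. What then remains for i < j is
  q^{jm} (q^{|m|} + q^{-|m|} - q^m - q^{-m}) = 0; for i = j and i = j + 1 some of these terms are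
  missing, which leaves q^{(j-1)m} and -q^{(j+1)m}.\<close>

lemma a_coeff_x:
  assumes "i \<in> {1..N}" "j \<in> {1..N - 1}"
  shows "(\<Sum>l=1..N. ac m i l * eps_x_coeff s m l j) = a_x_coeff q m i j"
proof -
  have "(\<Sum>l=1..N. ac m i l * eps_x_coeff s m l j)
    = (\<Sum>l=1..N. (if l = j then ac m i l * s powi \<bar>m\<bar> else 0)
        + (if l = j + 1 then - ac m i l * s powi (- \<bar>m\<bar>) else 0))"
    by (intro sum.cong) (auto simp: eps_x_coeff_def)
  also have "\<dots> = ac m i j * s powi \<bar>m\<bar> - ac m i (j + 1) * s powi (- \<bar>m\<bar>)"
    using assms by (auto simp: sum.distrib)
  also have "\<dots> = a_x_coeff q m i j"
  proof -
    define S where "S = s powi \<bar>m\<bar>"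
    define P where "P = q powi m"
    define R where "R = q powi (int j * m)"
    define V where "V = q powi ((int j - 1) * \<bar>m\<bar>)"
    have nz: "S \<noteq> 0" "P \<noteq> 0" by (simp_all add: S_def P_def q0 s0)
    have SS: "S * S = (if m \<ge> 0 then P else 1 / P)"
      by (simp add: S_def P_def s_powi_square power_int_minus divide_inverse)
    have R: "q powi ((int j + 1) * m) = R * P" "q powi ((int j - 1) * m) = R / P"
      using q0 by (simp_all add: R_def P_def distrib_right left_diff_distrib power_int_add power_int_diff)
    have VV: "q powi (int j * \<bar>m\<bar>) = V * (S * S)"
      using q0 unfolding S_def V_def s_powi_square
      by (simp add: left_diff_distrib power_int_diff)
    have e: "s powi (- \<bar>m\<bar>) = 1 / S" "q powi ((int j - 1) * m) = R / P"
      "q powi ((int (j + 1) - 1) * m) = R" "q powi (int (j + 1) * m) = R * P"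
      "q powi ((int (j + 1) - 1) * \<bar>m\<bar>) = V * (S * S)"
      using R VV by (simp_all add: S_def R_def V_def power_int_minus divide_inverse add.commute)
    have P: "P = (if m \<ge> 0 then S * S else 1 / (S * S))"
      using nz by (simp add: SS)
    define T where "T = q powi ((int i - 1) * m)"
    have T: "i = j \<Longrightarrow> T = R / P"
      by (simp add: T_def R(2))
    show ?thesis
      unfolding a_coeff_def a_x_coeff_def e S_def[symmetric] R_def[symmetric] V_def[symmetric]
        R
        T_def[symmetric]
      using nz by (auto simp: T P field_simps)
  qed
  finally show ?thesis .
qed

lemma sum_q_square:
  assumes "k \<ge> 1"
  shows "(\<Sum>l=1..N. (q ^ k) ^ (l - 1) * (q ^ k) ^ (l - 1)) = (r k) ^ 2"
proof -
  have "k * l + k * l = 2 * l * k" for l by simp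
  then have "(q ^ k) ^ l * (q ^ k) ^ l = q ^ (2 * l * k)" for l
    by (simp only: power_mult[symmetric] power_add[symmetric])
  then show ?thesis
    using r[OF assms] by (simp add: sum.atLeast1_atMost_eq)
qed

text \<open>Up to the rank one part, a row for -k has a single nonzero entry. The product thus
  reduces to one entry of the row for k, one telescoping sum and the square length of the rank one
  vector.\<close>

lemma a_coeff_gram_pos:
  assumes "i \<in> {1..N}" "j \<in> {1..N}" "k \<ge> 1"
  shows "(\<Sum>l=1..N. ac (int k) i l * ac (- int k) j l) = a_gram q (int k) i j"
proof -
  define S where "S = s ^ k"
  define P where "P = q ^ k"
  define \<rho> where "\<rho> = r k"
  \<comment> \<open>Row \<open>i\<close> of A(k) without its rank one part.\<close>
  define U where "U = (\<lambda>l. (if i \<le> l then P ^ l * S else 0) - (if i < l then P ^ (l - 1) / S else 0))"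
  have nz: "S \<noteq> 0" "P \<noteq> 0" "\<rho> \<noteq> 0"
    using assms by (simp_all add: S_def P_def \<rho>_def q0 s0 r_nonzero)
  have SS: "S * S = P"
    by (simp add: S_def P_def sq[symmetric] power2_eq_square power_mult_distrib)
  have qp: "q powi (int l * int k) = P ^ l" for l
    by (simp add: P_def mult.commute power_int_mult flip: power_mult)
  have qp': "q powi ((int l - 1) * int k) = P ^ (l - 1)" if "l \<ge> 1" for l
    using qp[of "l - 1"] that by (simp add: of_nat_diff)
  have P_Suc: "P ^ l = P * P ^ (l - 1)" if "l \<ge> 1" for l
    using that by (cases l) auto
  have pw: "P ^ (2 * n) = P ^ n * P ^ n" for n
    by (simp add: mult_2 power_add)
  have SS': "S * (S * z) = P * z" for z
    by (simp flip: SS)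
  have pos: "ac (int k) i l = U l + P ^ N * S / \<rho> * P ^ (l - 1)" if "l \<ge> 1" for l
    using that assms(3)
    by (simp add: a_coeff_def U_def qp qp' S_def[symmetric] \<rho>_def[symmetric] power_int_minus divide_inverse)
  \<comment> \<open>For l > j the two conditionals cancel: S^2 = P turns P^{-(l-1)} / S into S
    P^{-l}.\<close>
  have neg: "ac (- int k) j l = (if l = j then S / P ^ l else 0) - S / (\<rho> * P ^ N) * P ^ (l - 1)"
    if "l \<ge> 1" for l
  proof -
    have e: "1 / P ^ (l - 1) * (1 / S) = S / P ^ l"
      using nz SS P_Suc[OF that] by (simp add: field_simps)
    have "ac (- int k) j l = (if j \<le> l then 1 / P ^ l * S else 0)
        - (if j < l then 1 / P ^ (l - 1) * (1 / S) else 0)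
        + 1 / P ^ N * S * (- 1 / \<rho>) * P ^ (l - 1)"
      using that assms(3)
      by (simp add: a_coeff_def qp qp' S_def[symmetric] \<rho>_def[symmetric] power_int_minus divide_inverse)
    then show ?thesis unfolding e by (cases "j < l"; cases "l = j") (auto simp: field_simps)
  qed
  \<comment> \<open>The term at l = i is P^{2i} / S, and those with l > i are (P^{2l} - P^{2l-2}) /
    S, so the sum telescopes.\<close>
  have sumU: "(\<Sum>l=1..n. U l * P ^ (l - 1)) = P ^ (2 * n) / S" if "i \<le> n" for n
    using that
  proof (induction rule: dec_induct)
    case base
    have "(\<Sum>l=1..i. U l * P ^ (l - 1)) = (\<Sum>l=1..i. if l = i then U l * P ^ (l - 1) else 0)"
      by (intro sum.cong) (auto simp: U_def)
    moreover have "P ^ (2 * i) = P ^ i * (S * S * P ^ (i - 1))"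
      using P_Suc[of i] assms(1) by (simp add: SS mult_2 power_add)
    then have "(\<Sum>l=1..i. if l = i then U l * P ^ (l - 1) else 0) = P ^ (2 * i) / S"
      using assms(1) nz by (simp add: U_def field_simps)
    ultimately show ?case by simp
  next
    case (step n)
    have PS: "P * S = P * P / S" using SS nz by (simp add: field_simps)
    have "U (Suc n) = P ^ n * (P * S) - P ^ n / S"
      using step by (simp add: U_def)
    also have "\<dots> = (P ^ n * (P * P) - P ^ n) / S"
      unfolding PS by (simp add: diff_divide_distrib)
    finally show ?case
      using step unfolding pw by (simp add: add_divide_distrib[symmetric] algebra_simps)
  qed
  have sumP: "(\<Sum>l=1..N. P ^ (l - 1) * P ^ (l - 1)) = \<rho> ^ 2"
    unfolding P_def \<rho>_def by (rule sum_q_square[OF assms(3)])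
  have delta: "(\<Sum>l=1..N. if l = j then F l else 0) = F j" for F :: "nat \<Rightarrow> complex"
    using assms(2) by simp
  have "(\<Sum>l=1..N. ac (int k) i l * ac (- int k) j l)
    = (\<Sum>l=1..N. (if l = j then (U l + P ^ N * S / \<rho> * P ^ (l - 1)) * (S / P ^ l) else 0)
       - S / (\<rho> * P ^ N) * (U l * P ^ (l - 1))
       - P ^ N * S / \<rho> * (S / (\<rho> * P ^ N)) * (P ^ (l - 1) * P ^ (l - 1)))"
    by (intro sum.cong refl) (simp add: pos neg algebra_simps)
  also have "\<dots> = (U j + P ^ N * S / \<rho> * P ^ (j - 1)) * (S / P ^ j)
       - S / (\<rho> * P ^ N) * (P ^ (2 * N) / S)
       - P ^ N * S / \<rho> * (S / (\<rho> * P ^ N)) * \<rho> ^ 2"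
    unfolding sum_subtractf sum_distrib_left[symmetric] sumP delta using sumU[of N] assms(1) by simp
  \<comment> \<open>The mixed products are P^N / \<rho> with opposite signs. The two rank one parts
    contribute -S^2 = -P.\<close>
  also have "\<dots> = U j * S / P ^ j - P"
    unfolding pw using nz SS P_Suc[of j] assms(2) by (simp add: SS' power2_eq_square field_simps)
  also have "\<dots> = a_gram q (int k) i j"
    using nz SS P_Suc[of j] assms(2)
    by (auto simp: a_gram_def U_def power_int_minus P_def[symmetric] field_simps)
  finally show ?thesis .
qed

text \<open>Since g(-m) is the transpose of g(m), negative m follows by exchanging the two
  rows.\<close>

lemma a_coeff_gram:
  assumes "i \<in> {1..N}" "j \<in> {1..N}" "m \<noteq> 0"
  shows "(\<Sum>l=1..N. ac m i l * ac (- m) j l) = a_gram q m i j"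
proof (cases "m > 0")
  case True
  then show ?thesis using a_coeff_gram_pos[OF assms(1,2), of "nat m"] by simp
next
  case False
  then have "(\<Sum>l=1..N. ac (- m) j l * ac m i l) = a_gram q (- m) j i"
    using a_coeff_gram_pos[OF assms(2,1), of "nat (- m)"] assms(3) by simp
  then show ?thesis by (auto simp: a_gram_def mult.commute)
qed

lemma a_coeff_inj:
  assumes m: "m \<noteq> 0" and v: "\<And>i. i \<in> {1..N} \<Longrightarrow> (\<Sum>l=1..N. ac m i l * v l) = 0"
    and l: "l \<in> {1..N}"
  shows "v l = 0"
proof -
  define k where "k = nat \<bar>m\<bar>"
  define t where "t = q ^ k"
  define \<sigma> :: complex where "\<sigma> = of_int \<bar>m\<bar> / of_int m"
  have k: "k \<ge> 1" "\<bar>m\<bar> = int k" using m by (auto simp: k_def)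
  have \<sigma>: "\<sigma> ^ 2 = 1" using m by (auto simp: \<sigma>_def abs_if power2_eq_square)
  have step: "v (i + 1) = t * v i" if i: "i \<ge> 1" "i < N" for i
  proof -
    define S where "S = s powi \<bar>m\<bar>"
    have SS: "S * S = t" unfolding S_def s_powi_square by (simp add: k(2) t_def)
    have "0 = (\<Sum>l=1..N. ac m i l * v l) - (\<Sum>l=1..N. ac m (i + 1) l * v l)"
      using v[of i] v[of "i + 1"] i by simp
    also have "\<dots> = (\<Sum>l=1..N. (ac m i l - ac m (i + 1) l) * v l)"
      by (simp add: sum_subtractf left_diff_distrib)
    also have "\<dots> = (\<Sum>l=1..N. (if l = i then q powi (int i * m) * S * v l else 0)
        - (if l = i + 1 then q powi (int i * m) / S * v l else 0))"
      unfolding a_coeff_step by (intro sum.cong) (auto simp: S_def power_int_minus divide_inverse)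
    also have "\<dots> = q powi (int i * m) * (S * v i - v (i + 1) / S)"
      using i by (simp add: sum_subtractf right_diff_distrib)
    finally have "v (i + 1) = S * S * v i"
      using q0 s0 by (simp add: S_def field_simps)
    then show ?thesis by (simp add: SS)
  qed
  have vt: "v (Suc i) = t ^ i * v 1" if "Suc i \<le> N" for i
    using that by (induction i) (use step[of "Suc _"] in auto)
  \<comment> \<open>Against the vector (t^{l-1})_l the rank one part produces the square of
    \<open>r k\<close>, one factor of which cancels with its denominator. The summand epsilon_{Nm}
    gives t^{N-1}.\<close>
  have "(\<Sum>l=1..N. ac m N l * v l) = q powi (int N * m) * s powi \<bar>m\<bar> * (t ^ (N - 1) + \<sigma> * r k) * v 1"
  proof -
    let ?C = "q powi (int N * m) * s powi \<bar>m\<bar>"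
    have row: "ac m N l * v l = (if l = N then ?C * t ^ (N - 1) * v 1 else 0)
        + ?C * (\<sigma> / r k) * v 1 * (t ^ (l - 1) * t ^ (l - 1))" if l: "l \<in> {1..N}" for l
    proof -
      have "v l = t ^ (l - 1) * v 1" using vt[of "l - 1"] l by simp
      moreover have "q powi ((int l - 1) * \<bar>m\<bar>) = t ^ (l - 1)"
      proof -
        have "(int l - 1) * \<bar>m\<bar> = int (k * (l - 1))"
          using l by (simp add: k(2) of_nat_diff mult.commute)
        then show ?thesis by (simp only: power_int_of_nat power_mult t_def)
      qed
      ultimately show ?thesis
        using l by (simp add: a_coeff_def \<sigma>_def k_def algebra_simps)
    qed
    have "(\<Sum>l=1..N. ac m N l * v l) = (\<Sum>l=1..N. (if l = N then ?C * t ^ (N - 1) * v 1 else 0)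
        + ?C * (\<sigma> / r k) * v 1 * (t ^ (l - 1) * t ^ (l - 1)))"
      by (rule sum.cong[OF refl row])
    also have "\<dots> = ?C * t ^ (N - 1) * v 1
        + ?C * (\<sigma> / r k) * v 1 * (\<Sum>l=1..N. t ^ (l - 1) * t ^ (l - 1))"
      unfolding sum.distrib sum_distrib_left[symmetric] using N by simp
    also have "\<dots> = ?C * (t ^ (N - 1) + \<sigma> * r k) * v 1"
      using r_nonzero[OF k(1)] unfolding t_def sum_q_square[OF k(1)]
      by (simp add: power2_eq_square field_simps)
    finally show ?thesis .
  qed
  moreover have "t ^ (N - 1) + \<sigma> * r k \<noteq> 0"
  proof
    assume "t ^ (N - 1) + \<sigma> * r k = 0"
    \<comment> \<open>Squaring removes the choice of the root and the sign \<open>\<sigma>\<close>.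
      The left side is then the top summand of the square of \<open>r k\<close>, so the sum of the
      other N - 1 summands would vanish.\<close>
    then have "(t ^ (N - 1)) ^ 2 = (\<sigma> * r k) ^ 2"
      by (metis add_eq_0_iff2 power2_minus)
    also have "\<dots> = (\<Sum>l<N. q ^ (2 * l * k))"
      by (simp add: power_mult_distrib \<sigma> r[OF k(1)])
    also have "\<dots> = (\<Sum>l<N - 1. q ^ (2 * l * k)) + (t ^ (N - 1)) ^ 2"
      using N by (cases N) (simp_all add: t_def mult_ac flip: power_mult)
    finally have "(\<Sum>l<N - 1. q ^ (2 * l * k)) = 0" by simp
    moreover have "N - 1 \<ge> 1" using N by simp
    ultimately show False using sum_q_nonzero[OF k(1)] by blast
  qed
  ultimately have "v 1 = 0" using v[of N] N q0 s0 by auto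
  then show ?thesis using vt[of "l - 1"] l by simp
qed

end

section \<open>Transport of the relations\<close>

text \<open>The linear relations are transported by scalar combinations alone, so the argument is
  phrased with just this fragment of the ideal axioms.\<close>

definition lin_closed :: "'g falg set \<Rightarrow> bool"
  where "lin_closed S \<longleftrightarrow> 0 \<in> S \<and> (\<forall>p \<in> S. \<forall>p' \<in> S. p + p' \<in> S) \<and> (\<forall>c. \<forall>p \<in> S. sc c * p \<in> S)"

lemma lin_closed_ideal:
  assumes "ideal I (free_alg G)"
  shows "lin_closed I"
proof -
  interpret ideal I "free_alg G" by fact
  show ?thesis
    unfolding lin_closed_def using additive_subgroup.zero_closed[OF additive_subgroup_axioms]
      additive_subgroup.a_closed[OF additive_subgroup_axioms] I_l_closed[of _ "sc _"] by simp
qed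

lemma lin_closed_sum:
  "lin_closed S \<Longrightarrow> (\<And>x. x \<in> A \<Longrightarrow> g x \<in> S) \<Longrightarrow> (\<Sum>x\<in>A. sc (c x) * g x) \<in> S"
  by (induction A rule: infinite_finite_induct) (simp_all add: lin_closed_def)

lemma lin_closed_uminus: "lin_closed S \<Longrightarrow> p \<in> S \<Longrightarrow> - p \<in> S"
  using sc_uminus[of 1] by (metis lin_closed_def mult_minus1 sc_1)

lemma sc_sum: "sc (sum f A) = (\<Sum>x\<in>A. sc (f x))"
  by (induction A rule: infinite_finite_induct) (simp_all add: sc_add)

lemma comm_sum_left: "comm (\<Sum>i\<in>A. sc (c i) * e i) y = (\<Sum>i\<in>A. sc (c i) * comm (e i) y)"
  by (simp add: comm_def sum_distrib_left sum_distrib_right sum_subtractf right_diff_distrib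
      mult.assoc sc_left_commute)

lemma comm_sum_right: "comm y (\<Sum>i\<in>A. sc (c i) * e i) = (\<Sum>i\<in>A. sc (c i) * comm y (e i))"
  by (simp add: comm_def sum_distrib_left sum_distrib_right sum_subtractf right_diff_distrib
      mult.assoc sc_left_commute)

lemma comm_swap: "comm y x = - comm x y"
  by (simp add: comm_def)

text \<open>The bracket is linear and \<open>z\<close> does not depend on \<open>i\<close>, so the
  element is itself a scalar combination of the given ones.\<close>

lemma lin_closed_comm_sum:
  assumes S: "lin_closed S" and e: "\<And>i. i \<in> A \<Longrightarrow> comm (e i) y - sc (g i) * z \<in> S"
  shows "comm (\<Sum>i\<in>A. sc (c i) * e i) y - sc (\<Sum>i\<in>A. c i * g i) * z \<in> S"
proof -
  have "comm (\<Sum>i\<in>A. sc (c i) * e i) y - sc (\<Sum>i\<in>A. c i * g i) * z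
    = (\<Sum>i\<in>A. sc (c i) * (comm (e i) y - sc (g i) * z))"
    by (simp add: comm_sum_left sc_sum sc_mult sum_distrib_right right_diff_distrib sum_subtractf
        mult.assoc)
  also have "\<dots> \<in> S"
    by (rule lin_closed_sum[OF S e])
  finally show ?thesis .
qed

lemma lin_closed_comm_sum_sum:
  assumes S: "lin_closed S"
    and e: "\<And>i j. i \<in> A \<Longrightarrow> j \<in> B \<Longrightarrow> comm (e i) (e' j) - sc (g i j) * z \<in> S"
  shows "comm (\<Sum>i\<in>A. sc (c i) * e i) (\<Sum>j\<in>B. sc (d j) * e' j)
    - sc (\<Sum>i\<in>A. \<Sum>j\<in>B. c i * d j * g i j) * z \<in> S"
proof -
  have "comm (\<Sum>i\<in>A. sc (c i) * e i) (e' j) - sc (\<Sum>i\<in>A. c i * g i j) * z \<in> S" if "j \<in> B" for j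
    by (rule lin_closed_comm_sum[OF S e[OF _ that]])
  then have "(\<Sum>j\<in>B. sc (d j) * (comm (\<Sum>i\<in>A. sc (c i) * e i) (e' j)
      - sc (\<Sum>i\<in>A. c i * g i j) * z)) \<in> S"
    by (rule lin_closed_sum[OF S])
  moreover have "(\<Sum>i\<in>A. \<Sum>j\<in>B. c i * d j * g i j) = (\<Sum>j\<in>B. d j * (\<Sum>i\<in>A. c i * g i j))"
    unfolding sum_distrib_left by (subst sum.swap) (simp only: mult_ac)
  ultimately show ?thesis
    by (simp add: comm_sum_right right_diff_distrib sum_subtractf sc_sum[of _ B] sc_mult
        sum_distrib_right mult.assoc)
qed

section \<open>Families of linear relations with arbitrary structure constants\<close>

definition heis_term :: "complex \<Rightarrow> int \<Rightarrow> alg"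
  where "heis_term q m = sc (qint q m / of_int m) * qintc q m"

definition x_term :: "complex \<Rightarrow> sign \<Rightarrow> int \<Rightarrow> nat \<Rightarrow> int \<Rightarrow> alg"
  where "x_term q \<sigma> m j n = sc (of_int (sg \<sigma>) * (qint q m / of_int m))
    * cpow (- (sg \<sigma> * \<bar>m\<bar>)) * xv \<sigma> j (m + n)"

text \<open>With \<open>e\<close> and \<open>g\<close> as parameters both presentations become
  instances of one family, and one change of basis lemma serves both directions.\<close>

definition heis_rels :: "nat \<Rightarrow> complex \<Rightarrow> (nat \<Rightarrow> int \<Rightarrow> alg) \<Rightarrow> (int \<Rightarrow> nat \<Rightarrow> nat \<Rightarrow> complex) \<Rightarrow> alg set"
  where "heis_rels N q e g =
    {comm (e i m) (e j n) - sc (if m = - n then g m i j else 0) * heis_term q m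
      | i j m n. i \<in> {1..N} \<and> j \<in> {1..N} \<and> m \<noteq> 0 \<and> n \<noteq> 0}"

definition x_rels :: "nat \<Rightarrow> complex \<Rightarrow> (nat \<Rightarrow> int \<Rightarrow> alg) \<Rightarrow> (int \<Rightarrow> nat \<Rightarrow> nat \<Rightarrow> complex) \<Rightarrow> alg set"
  where "x_rels N q e g =
    {comm (e i m) (xv \<sigma> j n) - sc (g m i j) * x_term q \<sigma> m j n
      | \<sigma> i j m n. i \<in> {1..N} \<and> j \<in> {1..N - 1} \<and> m \<noteq> 0}"

text \<open>The structure constants transform like a bilinear form. The second factor is taken at -m
  because all constants vanish unless n = -m.\<close>

lemma heis_rels_change:
  assumes S: "lin_closed S" and sub: "heis_rels N q e g \<subseteq> S"
    and e': "\<And>i m. i \<in> {1..N} \<Longrightarrow> m \<noteq> 0 \<Longrightarrow> e' i m = (\<Sum>l=1..N. sc (c m i l) * e l m)"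
    and g': "\<And>i j m. i \<in> {1..N} \<Longrightarrow> j \<in> {1..N} \<Longrightarrow> m \<noteq> 0 \<Longrightarrow>
      (\<Sum>k=1..N. \<Sum>l=1..N. c m i k * c (- m) j l * g m k l) = g' m i j"
  shows "heis_rels N q e' g' \<subseteq> S"
proof -
  have "comm (e' i m) (e' j n) - sc (if m = - n then g' m i j else 0) * heis_term q m \<in> S"
    if ij: "i \<in> {1..N}" "j \<in> {1..N}" "m \<noteq> 0" "n \<noteq> 0" for i j m n
  proof -
    have "comm (e' i m) (e' j n) - sc (\<Sum>k=1..N. \<Sum>l=1..N. c m i k * c n j l *
        (if m = - n then g m k l else 0)) * heis_term q m \<in> S"
      unfolding e'[OF ij(1,3)] e'[OF ij(2,4)]
      by (rule lin_closed_comm_sum_sum[OF S]) (use sub ij in \<open>unfold heis_rels_def, blast\<close>)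
    moreover have "(\<Sum>k=1..N. \<Sum>l=1..N. c m i k * c n j l * (if m = - n then g m k l else 0))
      = (if m = - n then g' m i j else 0)"
      using g'[OF ij(1-3)] by (cases "m = - n") auto
    ultimately show ?thesis by simp
  qed
  then show ?thesis unfolding heis_rels_def by blast
qed

lemma x_rels_change:
  assumes S: "lin_closed S" and sub: "x_rels N q e g \<subseteq> S"
    and e': "\<And>i m. i \<in> {1..N} \<Longrightarrow> m \<noteq> 0 \<Longrightarrow> e' i m = (\<Sum>l=1..N. sc (c m i l) * e l m)"
    and g': "\<And>i j m. i \<in> {1..N} \<Longrightarrow> j \<in> {1..N - 1} \<Longrightarrow> m \<noteq> 0 \<Longrightarrow>
      (\<Sum>l=1..N. c m i l * g m l j) = g' m i j"
  shows "x_rels N q e' g' \<subseteq> S"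
proof -
  have "comm (e' i m) (xv \<sigma> j n) - sc (g' m i j) * x_term q \<sigma> m j n \<in> S"
    if ij: "i \<in> {1..N}" "j \<in> {1..N - 1}" "m \<noteq> 0" for \<sigma> i j m n
    unfolding e'[OF ij(1,3)] g'[OF ij, symmetric]
    by (rule lin_closed_comm_sum[OF S]) (use sub ij in \<open>unfold x_rels_def, blast\<close>)
  then show ?thesis unfolding x_rels_def by blast
qed

section \<open>Substitutions fixing the generators shared by both presentations\<close>

locale common_subst =
  fixes f :: "gen \<Rightarrow> alg"
  assumes K: "f (K \<sigma> i) = kv \<sigma> i" and X: "f (X \<sigma> j n) = xv \<sigma> j n" and Qc: "f (Qc \<sigma>) = var (Qc \<sigma>)"
begin

lemmas fix_common = K X Qc

lemma subst_comm: "falg_subst f (comm a b) = comm (falg_subst f a) (falg_subst f b)"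
  by (simp add: comm_def falg_subst_hom)

lemma subst_cpow [simp]: "falg_subst f (cpow t) = cpow t"
  by (simp add: cpow_def falg_subst_hom Qc)

lemma subst_heis_term [simp]: "falg_subst f (heis_term q m) = heis_term q m"
  by (simp add: heis_term_def qintc_def falg_subst_hom)

lemma subst_x_term [simp]: "falg_subst f (x_term q \<sigma> m j n) = x_term q \<sigma> m j n"
  by (simp add: x_term_def falg_subst_hom X)

lemma subst_heis_rels:
  assumes "p \<in> heis_rels N q e g"
  shows "falg_subst f p \<in> heis_rels N q (\<lambda>i m. falg_subst f (e i m)) g"
  using assms unfolding heis_rels_def by (force simp: falg_subst_hom subst_comm)

lemma subst_x_rels:
  assumes "p \<in> x_rels N q e g"
  shows "falg_subst f p \<in> x_rels N q (\<lambda>i m. falg_subst f (e i m)) g"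
  using assms unfolding x_rels_def by (force simp: falg_subst_hom subst_comm X)

text \<open>The constant coefficient of the exponent is set to 0, so \<open>h\<close> enters only at
  nonzero indices. This matches the range in which the two versions of h_{im} correspond.\<close>

lemma subst_kcur:
  assumes "\<And>m. m \<noteq> 0 \<Longrightarrow> falg_subst f (h i m) = h' i m"
  shows "falg_subst f (kcur q h \<sigma> i n) = kcur q h' \<sigma> i n"
proof -
  have nz: "l \<noteq> 0 \<Longrightarrow> sg \<sigma> * int l \<noteq> 0" for l
    by (cases \<sigma>) auto
  have "falg_subst f (if l = 0 then 0 else sc (of_int (sg \<sigma>) * (q - inverse q)) * h i (sg \<sigma> * int l))
      = (if l = 0 then 0 else sc (of_int (sg \<sigma>) * (q - inverse q)) * h' i (sg \<sigma> * int l))" for l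
    using nz[of l] assms by (simp add: falg_subst_hom)
  then show ?thesis
    unfolding kcur_def by (simp add: falg_subst_hom falg_subst_fexp K)
qed

text \<open>The unit relations, (R1), (R2) and (R4) contain only fixed generators, and (R3) follows
  \<open>h\<close>. Centrality alone has to be supplied for the images of the remaining
  generators.\<close>

lemma subst_common_rels:
  assumes h: "\<And>i m. i \<in> {1..N - 1} \<Longrightarrow> m \<noteq> 0 \<Longrightarrow> falg_subst f (h i m) = h' i m"
    and S: "common_rels N q H h' \<subseteq> S"
    and central: "\<And>g. g \<in> G \<Longrightarrow> comm (var (Qc Pl)) (f g) \<in> S"
    and p: "p \<in> common_rels N q G h"
  shows "falg_subst f p \<in> S"
proof -
  consider "p \<in> rels_units N" | "p \<in> rels_central G" | "p \<in> rels_R1 N q" | "p \<in> rels_R2 N"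
    | "p \<in> rels_R3 N q h" | "p \<in> rels_R4 N q"
    using p unfolding common_rels_def by blast
  then show ?thesis
  proof cases
    case 1
    then have "falg_subst f p = p"
      unfolding rels_units_def by (auto simp: falg_subst_hom fix_common)
    then show ?thesis using 1 S unfolding common_rels_def by auto
  next
    case 2
    then show ?thesis
      using central unfolding rels_central_def by (auto simp: subst_comm Qc)
  next
    case 3
    then have "falg_subst f p = p"
      unfolding rels_R1_def by (auto simp: falg_subst_hom X)
    then show ?thesis using 3 S unfolding common_rels_def by auto
  next
    case 4
    then have "falg_subst f p = p"
      unfolding rels_R2_def by (auto simp: subst_comm X)
    then show ?thesis using 4 S unfolding common_rels_def by auto
  next
    case 5
    then obtain i j m n where ij: "i \<in> {1..N - 1}" "j \<in> {1..N - 1}"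
      and p: "p = comm (xv Pl i m) (xv Mi j n)
      - (if i = j then sc (1 / (q - inverse q)) *
           (kcur q h Pl i (m + n) * cpow (m - n) - kcur q h Mi i (m + n) * cpow (n - m)) else 0)"
      unfolding rels_R3_def by blast
    have "falg_subst f p = comm (xv Pl i m) (xv Mi j n)
      - (if i = j then sc (1 / (q - inverse q)) *
           (kcur q h' Pl i (m + n) * cpow (m - n) - kcur q h' Mi i (m + n) * cpow (n - m)) else 0)"
      unfolding p using subst_kcur[where i = j and h = h and h' = h', OF h[OF ij(2)]]
      by (simp add: falg_subst_hom subst_comm X)
    then have "falg_subst f p \<in> rels_R3 N q h'"
      using ij unfolding rels_R3_def by blast
    then show ?thesis using S unfolding common_rels_def by auto
  next
    case 6
    then have "falg_subst f p = p"
      unfolding rels_R4_def serre_def by (auto simp: falg_subst_hom X)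
    then show ?thesis using 6 S unfolding common_rels_def by auto
  qed
qed

end

section \<open>The two presentations expressed by the parametrised families\<close>

lemma sc_mult_shift: "sc (a * b) * y * z = sc b * (sc a * y * z)"
  by (simp add: mult.commute[of a b] sc_mult mult.assoc)

lemma heis_relsI:
  "i \<in> {1..N} \<Longrightarrow> j \<in> {1..N} \<Longrightarrow> m \<noteq> 0 \<Longrightarrow> n \<noteq> 0 \<Longrightarrow>
    p = comm (e i m) (e j n) - sc (if m = - n then g m i j else 0) * heis_term q m \<Longrightarrow>
    p \<in> heis_rels N q e g"
  unfolding heis_rels_def by blast

lemma x_relsI:
  "i \<in> {1..N} \<Longrightarrow> j \<in> {1..N - 1} \<Longrightarrow> m \<noteq> 0 \<Longrightarrow>
    p = comm (e i m) (xv \<sigma> j n) - sc (g m i j) * x_term q \<sigma> m j n \<Longrightarrow> p \<in> x_rels N q e g"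
  unfolding x_rels_def by blast

text \<open>This inclusion splits a relation that is to be transported; the reverse inclusions below
  supply the relations available in the target.\<close>

lemma eps_rels_subset:
  "eps_rels N q s \<subseteq> heis_rels N q ep (\<lambda>m i j. if i = j then 1 else 0)
    \<union> x_rels N q ep (eps_x_coeff s) \<union> common_rels N q (eps_gens N) (h_eps s)"
  (is "_ \<subseteq> ?H \<union> ?X \<union> ?C")
proof -
  have "comm (ep i m) (ep j n)
      - (if i = j \<and> m = - n then sc (qint q m / of_int m) * qintc q m else 0) \<in> ?H"
    if "i \<in> {1..N}" "j \<in> {1..N}" "m \<noteq> 0" "n \<noteq> 0" for i j m n
    using that by (intro heis_relsI[of i N j m n]) (auto simp: heis_term_def)
  moreover have "comm (ep i m) (xv \<sigma> j n) \<in> ?X"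
    if "i \<in> {1..N}" "j \<in> {1..N - 1}" "m \<noteq> 0" "j \<noteq> i" "j \<noteq> i - 1" for \<sigma> i j m n
    using that by (intro x_relsI[of i N j m _ _ \<sigma> n]) (auto simp: eps_x_coeff_def)
  moreover have "comm (ep i m) (xv \<sigma> i n)
      - sc (of_int (sg \<sigma>) * (qint q m / of_int m) * s powi \<bar>m\<bar>)
          * cpow (- (sg \<sigma> * \<bar>m\<bar>)) * xv \<sigma> i (m + n) \<in> ?X"
    if "i \<in> {1..N - 1}" "m \<noteq> 0" for \<sigma> i m n
    unfolding sc_mult_shift[of _ "s powi \<bar>m\<bar>"]
    using that by (intro x_relsI[of i N i m _ _ \<sigma> n]) (auto simp: eps_x_coeff_def x_term_def)
  moreover have "comm (ep i m) (xv \<sigma> (i - 1) n)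
      + sc (of_int (sg \<sigma>) * (qint q m / of_int m) * s powi (- \<bar>m\<bar>))
          * cpow (- (sg \<sigma> * \<bar>m\<bar>)) * xv \<sigma> (i - 1) (m + n) \<in> ?X"
    if "i \<in> {2..N}" "m \<noteq> 0" for \<sigma> i m n
    unfolding sc_mult_shift[of _ "s powi (- \<bar>m\<bar>)"]
    using that by (intro x_relsI[of i N "i - 1" m _ _ \<sigma> n])
      (auto simp: eps_x_coeff_def x_term_def sc_uminus)
  ultimately show ?thesis
    unfolding eps_rels_def by - (intro Un_least; blast)
qed

lemma heis_rels_subset_eps_rels:
  "heis_rels N q ep (\<lambda>m i j. if i = j then 1 else 0) \<subseteq> eps_rels N q s"
proof -
  have "comm (ep i m) (ep j n) - sc (if m = - n then if i = j then 1 else 0 else 0) * heis_term q m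
    \<in> eps_rels N q s"
    if "i \<in> {1..N}" "j \<in> {1..N}" "m \<noteq> 0" "n \<noteq> 0" for i j m n
  proof -
    have "sc (if m = - n then if i = j then 1 else 0 else 0) * heis_term q m
      = (if i = j \<and> m = - n then sc (qint q m / of_int m) * qintc q m else 0)"
      by (simp add: heis_term_def)
    then show ?thesis unfolding eps_rels_def using that by (simp only:) blast
  qed
  then show ?thesis unfolding heis_rels_def by blast
qed

lemma x_rels_subset_eps_rels: "x_rels N q ep (eps_x_coeff s) \<subseteq> eps_rels N q s"
proof -
  have "comm (ep i m) (xv \<sigma> j n) - sc (eps_x_coeff s m i j) * x_term q \<sigma> m j n \<in> eps_rels N q s"
    if ij: "i \<in> {1..N}" "j \<in> {1..N - 1}" "m \<noteq> 0" for \<sigma> i j m n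
  proof -
    consider "i = j" | "i = j + 1" | "j \<noteq> i" "j \<noteq> i - 1" using ij by force
    then show ?thesis
    proof cases
      case 1
      have "comm (ep i m) (xv \<sigma> j n) - sc (eps_x_coeff s m i j) * x_term q \<sigma> m j n
        = comm (ep j m) (xv \<sigma> j n) - sc (of_int (sg \<sigma>) * (qint q m / of_int m) * s powi \<bar>m\<bar>)
          * cpow (- (sg \<sigma> * \<bar>m\<bar>)) * xv \<sigma> j (m + n)"
        unfolding sc_mult_shift[of _ "s powi \<bar>m\<bar>"] 1 by (simp add: eps_x_coeff_def x_term_def)
      then show ?thesis unfolding eps_rels_def using ij by (simp only:) blast
    next
      case 2
      have "comm (ep i m) (xv \<sigma> j n) - sc (eps_x_coeff s m i j) * x_term q \<sigma> m j n
        = comm (ep i m) (xv \<sigma> (i - 1) n) + sc (of_int (sg \<sigma>) * (qint q m / of_int m) * s powi (- \<bar>m\<bar>))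
          * cpow (- (sg \<sigma> * \<bar>m\<bar>)) * xv \<sigma> (i - 1) (m + n)"
        unfolding sc_mult_shift[of _ "s powi (- \<bar>m\<bar>)"] using 2 by (simp add: eps_x_coeff_def x_term_def sc_uminus)
      moreover have "i \<in> {2..N}" using 2 ij by auto
      ultimately show ?thesis unfolding eps_rels_def using ij(3) by (simp only:) blast
    next
      case 3
      then have "eps_x_coeff s m i j = 0" by (auto simp: eps_x_coeff_def)
      then have "comm (ep i m) (xv \<sigma> j n) - sc (eps_x_coeff s m i j) * x_term q \<sigma> m j n
        = comm (ep i m) (xv \<sigma> j n)" by simp
      then show ?thesis unfolding eps_rels_def using ij 3 by (simp only:) blast
    qed
  qed
  then show ?thesis unfolding x_rels_def by blast
qed

text \<open>The factor [m]/m is even in m and [mc] is odd.\<close>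

lemma heis_term_uminus: "heis_term q (- m) = - heis_term q m"
proof -
  have "qint q (- m) / of_int (- m) = qint q m / of_int m"
    by (simp add: qint_def diff_divide_distrib minus_divide_left[symmetric] minus_divide_right[symmetric])
  moreover have "qintc q (- m) = - qintc q m"
    by (simp add: qintc_def right_diff_distrib)
  ultimately show ?thesis by (simp add: heis_term_def)
qed

lemma heis_term_scaled: "sc (qint q m / of_int m * c) * qintc q m = sc c * heis_term q m"
  by (simp only: heis_term_def mult.commute[of _ c] sc_mult mult.assoc)

lemma a_rels_subset:
  "a_rels N q \<subseteq> heis_rels N q av (a_gram q)
    \<union> x_rels N q av (a_x_coeff q) \<union> common_rels N q (a_gens N) (h_a q)"
  (is "_ \<subseteq> ?H \<union> ?X \<union> ?C")
proof -
  have "comm (av i m) (av i n) \<in> ?H" if "i \<in> {1..N}" "m \<noteq> 0" "n \<noteq> 0" for i m n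
    using that by (intro heis_relsI[of i N i m n]) (auto simp: a_gram_def)
  moreover have "comm (av i m) (av j n)
      + (if m = - n then sc (qint q m / of_int m * q powi m) * qintc q m else 0) \<in> ?H"
    if "i \<in> {1..N}" "j \<in> {1..N}" "i > j" "m \<noteq> 0" "n \<noteq> 0" for i j m n
    unfolding heis_term_scaled
    using that by (intro heis_relsI[of i N j m n]) (auto simp: a_gram_def sc_uminus)
  moreover have "comm (av i m) (xv \<sigma> j n) \<in> ?X"
    if "i \<in> {1..N}" "j \<in> {1..N - 1}" "m \<noteq> 0" "j \<noteq> i" "j \<noteq> i - 1" for \<sigma> i j m n
    using that by (intro x_relsI[of i N j m _ _ \<sigma> n]) (auto simp: a_x_coeff_def)
  moreover have "comm (av i m) (xv \<sigma> i n)
      - sc (of_int (sg \<sigma>) * (qint q m / of_int m) * q powi ((int i - 1) * m))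
          * cpow (- (sg \<sigma> * \<bar>m\<bar>)) * xv \<sigma> i (m + n) \<in> ?X"
    if "i \<in> {1..N - 1}" "m \<noteq> 0" for \<sigma> i m n
    unfolding sc_mult_shift[of _ "q powi ((int i - 1) * m)"]
    using that by (intro x_relsI[of i N i m _ _ \<sigma> n]) (auto simp: a_x_coeff_def x_term_def)
  moreover have "comm (av (i + 1) m) (xv \<sigma> i n)
      + sc (of_int (sg \<sigma>) * (qint q m / of_int m) * q powi ((int i + 1) * m))
          * cpow (- (sg \<sigma> * \<bar>m\<bar>)) * xv \<sigma> i (m + n) \<in> ?X"
    if "i \<in> {1..N - 1}" "m \<noteq> 0" for \<sigma> i m n
    unfolding sc_mult_shift[of _ "q powi ((int i + 1) * m)"]
    using that by (intro x_relsI[of "i + 1" N i m _ _ \<sigma> n])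
      (auto simp: a_x_coeff_def x_term_def sc_uminus)
  ultimately show ?thesis
    unfolding a_rels_def by - (intro Un_least; blast)
qed

text \<open>The presentation lists only i = j and i > j. For i < j, exchanging the arguments
  replaces m by -m, and the sign of the bracket is absorbed by the oddness of
  \<open>heis_term\<close>. This yields the negative of a listed relation, hence the inclusion into
  a linearly closed set.\<close>

lemma heis_rels_subset_a_rels:
  assumes S: "lin_closed S" and sub: "a_rels N q \<subseteq> S"
  shows "heis_rels N q av (a_gram q) \<subseteq> S"
proof -
  have gt: "comm (av i m) (av j n) - sc (if m = - n then - (q powi m) else 0) * heis_term q m \<in> S"
    if ij: "i \<in> {1..N}" "j \<in> {1..N}" "i > j" "m \<noteq> 0" "n \<noteq> 0" for i j m n
  proof -
    have "comm (av i m) (av j n) - sc (if m = - n then - (q powi m) else 0) * heis_term q m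
      = comm (av i m) (av j n)
      + (if m = - n then sc (qint q m / of_int m * q powi m) * qintc q m else 0)"
      unfolding heis_term_scaled by (simp add: sc_uminus)
    also have "\<dots> \<in> a_rels N q" unfolding a_rels_def using ij by blast
    finally show ?thesis using sub by blast
  qed
  have "comm (av i m) (av j n) - sc (if m = - n then a_gram q m i j else 0) * heis_term q m \<in> S"
    if ij: "i \<in> {1..N}" "j \<in> {1..N}" "m \<noteq> 0" "n \<noteq> 0" for i j m n
  proof -
    consider "i = j" | "i > j" | "i < j" by linarith
    then show ?thesis
    proof cases
      case 1
      have "comm (av i m) (av i n) \<in> a_rels N q" unfolding a_rels_def using ij by blast
      then show ?thesis using 1 sub by (auto simp: a_gram_def)
    next
      case 2
      then have "a_gram q m i j = - (q powi m)" by (simp add: a_gram_def)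
      then show ?thesis using gt[OF ij(1,2) 2 ij(3,4)] by (simp only:)
    next
      case 3
      have "comm (av i m) (av j n) - sc (if m = - n then a_gram q m i j else 0) * heis_term q m
        = - (comm (av j n) (av i m) - sc (if n = - m then - (q powi n) else 0) * heis_term q n)"
        using 3 heis_term_uminus[of q m]
        by (auto simp: a_gram_def sc_uminus comm_swap[of "av j n"])
      then show ?thesis using lin_closed_uminus[OF S gt[OF ij(2,1) 3 ij(4,3)]] by simp
    qed
  qed
  then show ?thesis unfolding heis_rels_def by blast
qed

lemma x_rels_subset_a_rels: "x_rels N q av (a_x_coeff q) \<subseteq> a_rels N q"
proof -
  have "comm (av i m) (xv \<sigma> j n) - sc (a_x_coeff q m i j) * x_term q \<sigma> m j n \<in> a_rels N q"
    if ij: "i \<in> {1..N}" "j \<in> {1..N - 1}" "m \<noteq> 0" for \<sigma> i j m n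
  proof -
    consider "i = j" | "i = j + 1" | "j \<noteq> i" "j \<noteq> i - 1" using ij by force
    then show ?thesis
    proof cases
      case 1
      have "comm (av i m) (xv \<sigma> j n) - sc (a_x_coeff q m i j) * x_term q \<sigma> m j n
        = comm (av j m) (xv \<sigma> j n)
          - sc (of_int (sg \<sigma>) * (qint q m / of_int m) * q powi ((int j - 1) * m))
          * cpow (- (sg \<sigma> * \<bar>m\<bar>)) * xv \<sigma> j (m + n)"
        unfolding sc_mult_shift[of _ "q powi ((int j - 1) * m)"] 1
        by (simp add: a_x_coeff_def x_term_def)
      then show ?thesis unfolding a_rels_def using ij by (simp only:) blast
    next
      case 2
      have "comm (av i m) (xv \<sigma> j n) - sc (a_x_coeff q m i j) * x_term q \<sigma> m j n
        = comm (av (j + 1) m) (xv \<sigma> j n)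
          + sc (of_int (sg \<sigma>) * (qint q m / of_int m) * q powi ((int j + 1) * m))
          * cpow (- (sg \<sigma> * \<bar>m\<bar>)) * xv \<sigma> j (m + n)"
        unfolding sc_mult_shift[of _ "q powi ((int j + 1) * m)"] 2
        by (simp add: a_x_coeff_def x_term_def sc_uminus)
      then show ?thesis unfolding a_rels_def using ij by (simp only:) blast
    next
      case 3
      then have "a_x_coeff q m i j = 0" by (auto simp: a_x_coeff_def)
      then have "comm (av i m) (xv \<sigma> j n) - sc (a_x_coeff q m i j) * x_term q \<sigma> m j n
        = comm (av i m) (xv \<sigma> j n)" by simp
      then show ?thesis unfolding a_rels_def using ij 3 by (simp only:) blast
    qed
  qed
  then show ?thesis unfolding x_rels_def by blast
qed

lemma common_rels_subset:
  "common_rels N q (eps_gens N) (h_eps s) \<subseteq> eps_rels N q s"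
  "common_rels N q (a_gens N) (h_a q) \<subseteq> a_rels N q"
  by (auto simp: eps_rels_def a_rels_def)

section \<open>The relations lie in the free algebra on the generators\<close>

lemma gens_simps [simp]:
  "K \<sigma> i \<in> common_gens N \<longleftrightarrow> 1 \<le> i \<and> i \<le> N" "X \<sigma> j n \<in> common_gens N \<longleftrightarrow> 1 \<le> j \<and> j \<le> N - 1"
  "Qc \<sigma> \<in> common_gens N" "Eps i m \<notin> common_gens N" "Ag i m \<notin> common_gens N"
  "K \<sigma> i \<in> eps_gens N \<longleftrightarrow> 1 \<le> i \<and> i \<le> N" "X \<sigma> j n \<in> eps_gens N \<longleftrightarrow> 1 \<le> j \<and> j \<le> N - 1"
  "K \<sigma> i \<in> a_gens N \<longleftrightarrow> 1 \<le> i \<and> i \<le> N" "X \<sigma> j n \<in> a_gens N \<longleftrightarrow> 1 \<le> j \<and> j \<le> N - 1"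
  "Qc \<sigma> \<in> eps_gens N" "Qc \<sigma> \<in> a_gens N"
  "Eps i m \<in> eps_gens N \<longleftrightarrow> 1 \<le> i \<and> i \<le> N \<and> m \<noteq> 0"
  "Ag i m \<in> a_gens N \<longleftrightarrow> 1 \<le> i \<and> i \<le> N \<and> m \<noteq> 0"
  by (auto simp: common_gens_def eps_gens_def a_gens_def)

lemma common_gens_subset: "common_gens N \<subseteq> eps_gens N" "common_gens N \<subseteq> a_gens N"
  by (auto simp: eps_gens_def a_gens_def)

lemmas fcar_intros = fcar_add fcar_diff fcar_mult fcar_uminus fcar_sum fcar_power

lemma fcar_comm: "a \<in> fcar G \<Longrightarrow> b \<in> fcar G \<Longrightarrow> comm a b \<in> fcar G"
  by (simp add: comm_def fcar_intros)

lemma fcar_cpow: "range Qc \<subseteq> G \<Longrightarrow> cpow t \<in> fcar G"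
  by (auto simp: cpow_def subset_iff intro!: fcar_power)

lemma fcar_kcur:
  assumes "K \<sigma> i \<in> G" "\<And>m. m \<noteq> 0 \<Longrightarrow> h i m \<in> fcar G"
  shows "kcur q h \<sigma> i n \<in> fcar G"
proof -
  have "l \<noteq> 0 \<Longrightarrow> sg \<sigma> * int l \<noteq> 0" for l
    by (cases \<sigma>) auto
  then show ?thesis
    unfolding kcur_def using assms by (auto intro!: fcar_mult fcar_fexp)
qed

lemma fcar_common_rels:
  assumes G: "common_gens N \<subseteq> G" and h: "\<And>i m. i \<in> {1..N - 1} \<Longrightarrow> m \<noteq> 0 \<Longrightarrow> h i m \<in> fcar G"
  shows "common_rels N q G h \<subseteq> fcar G"
proof -
  have KG: "K \<sigma> i \<in> G" if "1 \<le> i" "i \<le> N" for \<sigma> i using G that by (auto simp: subset_iff)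
  have XG: "X \<sigma> j n \<in> G" if "j \<in> {1..N - 1}" for \<sigma> j n using G that by (auto simp: subset_iff)
  have QG: "Qc \<sigma> \<in> G" for \<sigma> using G by (auto simp: subset_iff)
  have cp: "cpow t \<in> fcar G" for t using QG by (auto intro: fcar_cpow)
  have kc: "kcur q h \<sigma> i n \<in> fcar G" if "i \<in> {1..N - 1}" for \<sigma> i n
    using that by (intro fcar_kcur KG h) auto
  have "rels_units N \<subseteq> fcar G"
    unfolding rels_units_def using KG QG by (auto intro!: fcar_intros)
  moreover have "rels_central G \<subseteq> fcar G"
    unfolding rels_central_def using QG by (auto intro!: fcar_comm)
  moreover have "rels_R1 N q \<subseteq> fcar G"
    unfolding rels_R1_def using XG by (auto intro!: fcar_intros)
  moreover have "rels_R2 N \<subseteq> fcar G"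
    unfolding rels_R2_def using XG by (auto intro!: fcar_comm)
  moreover have "rels_R3 N q h \<subseteq> fcar G"
    unfolding rels_R3_def using XG by (auto intro!: fcar_comm fcar_intros cp kc)
  moreover have "rels_R4 N q \<subseteq> fcar G"
    unfolding rels_R4_def serre_def using XG by (auto intro!: fcar_intros)
  ultimately show ?thesis unfolding common_rels_def by blast
qed

lemma fcar_heis_x_rels:
  assumes G: "common_gens N \<subseteq> G" and e: "\<And>i m. i \<in> {1..N} \<Longrightarrow> m \<noteq> 0 \<Longrightarrow> e i m \<in> fcar G"
  shows "heis_rels N q e g \<subseteq> fcar G" "x_rels N q e g \<subseteq> fcar G"
proof -
  have XG: "X \<sigma> j n \<in> G" if "j \<in> {1..N - 1}" for \<sigma> j n using G that by (auto simp: subset_iff)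
  have cp: "cpow t \<in> fcar G" for t using G by (auto simp: subset_iff intro: fcar_cpow)
  have "heis_term q m \<in> fcar G" for m
    unfolding heis_term_def qintc_def by (intro fcar_intros cp fcar_sc)
  then show "heis_rels N q e g \<subseteq> fcar G"
    unfolding heis_rels_def using e by (auto intro!: fcar_comm fcar_intros)
  have "x_term q \<sigma> m j n \<in> fcar G" if "j \<in> {1..N - 1}" for \<sigma> m j n
    unfolding x_term_def using XG[OF that] by (auto intro!: fcar_intros cp)
  then show "x_rels N q e g \<subseteq> fcar G"
    unfolding x_rels_def using e XG by (auto intro!: fcar_comm fcar_intros)
qed

text \<open>The results on generated ideals presuppose a subset of the carrier. Containment is read
  off from the parametrised families.\<close>

lemma eps_rels_carrier: "eps_rels N q s \<subseteq> fcar (eps_gens N)"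
proof -
  have "common_rels N q (eps_gens N) (h_eps s) \<subseteq> fcar (eps_gens N)"
    by (rule fcar_common_rels[OF common_gens_subset(1)]) (auto simp: h_eps_def intro!: fcar_intros)
  then show ?thesis
    using eps_rels_subset[of N q s] fcar_heis_x_rels[OF common_gens_subset(1), of N ep q] by fastforce
qed

lemma a_rels_carrier: "a_rels N q \<subseteq> fcar (a_gens N)"
proof -
  have "common_rels N q (a_gens N) (h_a q) \<subseteq> fcar (a_gens N)"
    by (rule fcar_common_rels[OF common_gens_subset(2)]) (auto simp: h_a_def intro!: fcar_intros)
  then show ?thesis
    using a_rels_subset[of N q] fcar_heis_x_rels[OF common_gens_subset(2), of N av q] by fastforce
qed

section \<open>The isomorphism\<close>

context gl_params
begin

text \<open>The inverse of A(m) is only chosen, not computed: the two product identities determine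
  everything that follows.\<close>

definition inv_coeff :: "int \<Rightarrow> nat \<Rightarrow> nat \<Rightarrow> complex"
  where "inv_coeff m = (SOME b. \<forall>i \<in> {1..N}. \<forall>k \<in> {1..N}.
    (\<Sum>l=1..N. ac m i l * b l k) = (if i = k then 1 else 0) \<and>
    (\<Sum>l=1..N. b i l * ac m l k) = (if i = k then 1 else 0))"

lemma inv_coeff:
  assumes "m \<noteq> 0" "i \<in> {1..N}" "k \<in> {1..N}"
  shows "(\<Sum>l=1..N. ac m i l * inv_coeff m l k) = (if i = k then 1 else 0)"
    and "(\<Sum>l=1..N. inv_coeff m i l * ac m l k) = (if i = k then 1 else 0)"
proof -
  have "\<exists>b. \<forall>i \<in> {1..N}. \<forall>k \<in> {1..N}.
    (\<Sum>l=1..N. ac m i l * b l k) = (if i = k then 1 else 0) \<and>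
    (\<Sum>l=1..N. b i l * ac m l k) = (if i = k then 1 else 0)"
    by (rule inverse_coefficients) (rule a_coeff_inj[OF assms(1)])
  from someI_ex[OF this] show "(\<Sum>l=1..N. ac m i l * inv_coeff m l k) = (if i = k then 1 else 0)"
    and "(\<Sum>l=1..N. inv_coeff m i l * ac m l k) = (if i = k then 1 else 0)"
    using assms unfolding inv_coeff_def[symmetric] by blast+
qed

lemma inv_coeff_sum_ac:
  assumes "m \<noteq> 0" "i \<in> {1..N}"
  shows "(\<Sum>k=1..N. inv_coeff m i k * (\<Sum>l=1..N. ac m k l * z l)) = z i"
proof -
  have "(\<Sum>k=1..N. inv_coeff m i k * (\<Sum>l=1..N. ac m k l * z l))
    = (\<Sum>l=1..N. \<Sum>k=1..N. inv_coeff m i k * ac m k l * z l)"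
    unfolding sum_distrib_left by (subst sum.swap) (simp only: mult.assoc)
  also have "\<dots> = (\<Sum>l=1..N. if i = l then z l else 0)"
    by (intro sum.cong refl) (simp add: inv_coeff(2)[OF assms, simplified] flip: sum_distrib_right)
  finally show ?thesis using assms(2) by simp
qed

lemma inv_coeff_x:
  assumes "m \<noteq> 0" "i \<in> {1..N}" "j \<in> {1..N - 1}"
  shows "(\<Sum>l=1..N. inv_coeff m i l * a_x_coeff q m l j) = eps_x_coeff s m i j"
proof -
  have "(\<Sum>l=1..N. inv_coeff m i l * a_x_coeff q m l j)
    = (\<Sum>k=1..N. inv_coeff m i k * (\<Sum>l=1..N. ac m k l * eps_x_coeff s m l j))"
    by (intro sum.cong refl) (simp add: a_coeff_x[OF _ assms(3), simplified])
  then show ?thesis using inv_coeff_sum_ac[OF assms(1,2)] by simp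
qed

text \<open>In g(m) = A(m) A(-m)^T, cancelling the right factor leaves A(m), which is
  \<open>inner\<close>; cancelling A(m) leaves the identity matrix.\<close>

lemma inv_coeff_gram:
  assumes "m \<noteq> 0" "i \<in> {1..N}" "j \<in> {1..N}"
  shows "(\<Sum>k=1..N. \<Sum>l=1..N. inv_coeff m i k * inv_coeff (- m) j l * a_gram q m k l) = (if i = j then 1 else 0)"
proof -
  have inner: "(\<Sum>l=1..N. inv_coeff (- m) j l * a_gram q m k l) = ac m k j" if "k \<in> {1..N}" for k
  proof -
    have "(\<Sum>l=1..N. inv_coeff (- m) j l * a_gram q m k l)
      = (\<Sum>l=1..N. inv_coeff (- m) j l * (\<Sum>p=1..N. ac (- m) l p * ac m k p))"
      using a_coeff_gram[OF that _ assms(1)] by (intro sum.cong refl) (simp add: mult.commute)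
    then show ?thesis using inv_coeff_sum_ac[of "- m" j "ac m k"] assms by simp
  qed
  have "(\<Sum>k=1..N. \<Sum>l=1..N. inv_coeff m i k * inv_coeff (- m) j l * a_gram q m k l)
    = (\<Sum>k=1..N. inv_coeff m i k * (\<Sum>l=1..N. inv_coeff (- m) j l * a_gram q m k l))"
    by (simp only: sum_distrib_left mult.assoc)
  also have "\<dots> = (\<Sum>k=1..N. inv_coeff m i k * ac m k j)"
    by (rule sum.cong) (simp_all only: inner)
  finally show ?thesis using inv_coeff(2)[OF assms] by simp
qed

section \<open>The two mutually inverse substitutions\<close>

definition to_a :: "gen \<Rightarrow> alg"
  where "to_a g = (case g of Eps i m \<Rightarrow> \<Sum>k=1..N. sc (inv_coeff m i k) * av k m | _ \<Rightarrow> var g)"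

definition to_eps :: "gen \<Rightarrow> alg"
  where "to_eps g = (case g of Ag i m \<Rightarrow> a_elt N q s r i m | _ \<Rightarrow> var g)"

sublocale to_a: common_subst to_a
  by unfold_locales (simp_all add: to_a_def)

sublocale to_eps: common_subst to_eps
  by unfold_locales (simp_all add: to_eps_def)

lemma to_a_common: "g \<in> common_gens N \<Longrightarrow> to_a g = var g"
  and to_eps_common: "g \<in> common_gens N \<Longrightarrow> to_eps g = var g"
  by (auto simp: to_a_def to_eps_def common_gens_def)

lemma sum_matrix:
  assumes "i \<in> {1..N}" "\<And>k. k \<in> {1..N} \<Longrightarrow> (\<Sum>l=1..N. a l * b l k) = (if i = k then 1 else 0)"
  shows "(\<Sum>l=1..N. sc (a l) * (\<Sum>k=1..N. sc (b l k) * e k)) = (e i :: alg)"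
proof -
  have "(\<Sum>l=1..N. sc (a l) * (\<Sum>k=1..N. sc (b l k) * e k))
    = (\<Sum>k=1..N. sc (\<Sum>l=1..N. a l * b l k) * e k)"
    unfolding sum_distrib_left sc_sum sum_distrib_right
    by (subst sum.swap) (simp only: sc_mult mult.assoc)
  also have "\<dots> = (\<Sum>k=1..N. sc (if k = i then 1 else 0) * e k)"
    by (intro sum.cong refl) (auto simp: assms(2)[simplified])
  finally show ?thesis using sum_if_lin[OF assms(1), of "\<lambda>_. 1" e] by simp
qed

lemma subst_to_a_a_elt:
  assumes "i \<in> {1..N}" "m \<noteq> 0"
  shows "falg_subst to_a (a_elt N q s r i m) = av i m"
proof -
  have "falg_subst to_a (a_elt N q s r i m)
    = (\<Sum>l=1..N. sc (ac m i l) * (\<Sum>k=1..N. sc (inv_coeff m l k) * av k m))"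
    unfolding a_elt_eq_sum[OF assms(1)] by (simp add: falg_subst_hom to_a_def)
  then show ?thesis using sum_matrix[OF assms(1) inv_coeff(1)[OF assms(2,1)]] by simp
qed

lemma subst_to_eps_to_a:
  assumes "g \<in> eps_gens N"
  shows "falg_subst to_eps (to_a g) = var g"
proof (cases "g \<in> common_gens N")
  case True
  then show ?thesis by (simp add: to_a_common to_eps_common)
next
  case False
  then obtain i m where g: "g = Eps i m" "i \<in> {1..N}" "m \<noteq> 0"
    using assms unfolding eps_gens_def by auto
  have "falg_subst to_eps (to_a g)
    = (\<Sum>l=1..N. sc (inv_coeff m i l) * (\<Sum>k=1..N. sc (ac m l k) * ep k m))"
    unfolding g(1) by (simp add: to_a_def falg_subst_hom) (simp add: to_eps_def a_elt_eq_sum)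
  then show ?thesis using sum_matrix[OF g(2) inv_coeff(2)[OF g(3,2)]] g(1) by simp
qed

lemma subst_to_a_to_eps:
  assumes "g \<in> a_gens N"
  shows "falg_subst to_a (to_eps g) = var g"
proof (cases "g \<in> common_gens N")
  case True
  then show ?thesis by (simp add: to_a_common to_eps_common)
next
  case False
  then obtain i m where "g = Ag i m" "i \<in> {1..N}" "m \<noteq> 0"
    using assms unfolding a_gens_def by auto
  then show ?thesis using subst_to_a_a_elt by (simp add: to_eps_def)
qed

text \<open>The partial sums defining a_{im} have consecutive difference q^{im} h_{im}, an identity
  of the free algebra that lets the exponentials in (R3) correspond exactly.\<close>

lemma subst_to_eps_h_a:
  assumes "i \<in> {1..N - 1}" "m \<noteq> 0"
  shows "falg_subst to_eps (h_a q i m) = h_eps s i m"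
proof -
  have "i < N" using assms by auto
  have "falg_subst to_eps (h_a q i m)
    = sc (q powi (- (int i * m))) * (a_elt N q s r i m - a_elt N q s r (i + 1) m)"
    by (simp add: h_a_def falg_subst_hom to_eps_def)
  also have "\<dots> = sc (q powi (- (int i * m)) * q powi (int i * m)) * h_eps s i m"
    using a_elt_step[OF \<open>i < N\<close>, of q s r m] by (simp add: sc_mult mult.assoc)
  also have "q powi (- (int i * m)) * q powi (int i * m) = 1"
    using q0 by (simp add: power_int_minus)
  finally show ?thesis by simp
qed

text \<open>Applying the inverse substitution to the previous identity avoids the entries of the
  inverse matrix.\<close>

lemma subst_to_a_h_eps:
  assumes "i \<in> {1..N - 1}" "m \<noteq> 0"
  shows "falg_subst to_a (h_eps s i m) = h_a q i m"
proof -
  have "h_a q i m \<in> fcar (a_gens N)"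
    using assms by (auto simp: h_a_def intro!: fcar_intros)
  then have "falg_subst to_a (falg_subst to_eps (h_a q i m)) = h_a q i m"
    by (rule falg_subst_inverse) (rule subst_to_a_to_eps)
  then show ?thesis by (simp add: subst_to_eps_h_a[OF assms])
qed

lemma to_a_closed: "g \<in> eps_gens N \<Longrightarrow> to_a g \<in> fcar (a_gens N)"
  by (auto simp: to_a_def eps_gens_def common_gens_def intro!: fcar_intros)

lemma to_eps_closed: "g \<in> a_gens N \<Longrightarrow> to_eps g \<in> fcar (eps_gens N)"
  by (auto simp: to_eps_def a_gens_def common_gens_def a_elt_eq_sum intro!: fcar_intros)

lemma lin_closed_central:
  assumes "lin_closed S" "\<And>k. k \<in> {1..N} \<Longrightarrow> comm (var (Qc Pl)) (e k) \<in> S"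
  shows "comm (var (Qc Pl)) (\<Sum>k=1..N. sc (c k) * e k) \<in> S"
  unfolding comm_sum_right by (rule lin_closed_sum) (use assms in auto)

lemma subst_to_a_rels:
  assumes "p \<in> eps_rels N q s"
  shows "falg_subst to_a p \<in> rel_ideal (a_gens N) (a_rels N q)"
proof -
  let ?J = "rel_ideal (a_gens N) (a_rels N q)"
  have S: "lin_closed ?J"
    by (rule lin_closed_ideal[OF ideal_rel_ideal[OF a_rels_carrier]])
  have sub: "a_rels N q \<subseteq> ?J"
    by (rule rel_ideal_self[OF a_rels_carrier])
  have e: "falg_subst to_a (ep i m) = (\<Sum>l=1..N. sc (inv_coeff m i l) * av l m)" for i m
    by (simp add: to_a_def)
  have "heis_rels N q (\<lambda>i m. falg_subst to_a (ep i m)) (\<lambda>m i j. if i = j then 1 else 0) \<subseteq> ?J"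
    by (rule heis_rels_change[OF S heis_rels_subset_a_rels[OF S sub] e inv_coeff_gram])
  moreover have "x_rels N q (\<lambda>i m. falg_subst to_a (ep i m)) (eps_x_coeff s) \<subseteq> ?J"
    by (rule x_rels_change[OF S order_trans[OF x_rels_subset_a_rels sub] e inv_coeff_x])
  moreover have "falg_subst to_a p \<in> ?J" if "p \<in> common_rels N q (eps_gens N) (h_eps s)"
  proof (rule to_a.subst_common_rels[OF subst_to_a_h_eps _ _ that])
    show "common_rels N q (a_gens N) (h_a q) \<subseteq> ?J"
      using common_rels_subset(2) sub by blast
    have central: "comm (var (Qc Pl)) (var g) \<in> ?J" if "g \<in> a_gens N" for g
      using sub that unfolding a_rels_def common_rels_def rels_central_def by blast
    fix g assume g: "g \<in> eps_gens N"
    show "comm (var (Qc Pl)) (to_a g) \<in> ?J"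
    proof (cases "g \<in> common_gens N")
      case True
      then show ?thesis using central[of g] common_gens_subset(2)[of N] by (auto simp: to_a_common)
    next
      case False
      then obtain i m where g: "g = Eps i m" "i \<in> {1..N}" "m \<noteq> 0"
        using g unfolding eps_gens_def by auto
      have "to_a g = (\<Sum>l=1..N. sc (inv_coeff m i l) * av l m)" by (simp add: g(1) to_a_def)
      then show ?thesis
        by (simp only:) (rule lin_closed_central[OF S central], use g in simp)
    qed
  qed
  ultimately show ?thesis
    using assms eps_rels_subset[of N q s] to_a.subst_heis_rels[of p] to_a.subst_x_rels[of p] by blast
qed

lemma subst_to_eps_rels:
  assumes "p \<in> a_rels N q"
  shows "falg_subst to_eps p \<in> rel_ideal (eps_gens N) (eps_rels N q s)"
proof -
  let ?I = "rel_ideal (eps_gens N) (eps_rels N q s)"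
  have S: "lin_closed ?I"
    by (rule lin_closed_ideal[OF ideal_rel_ideal[OF eps_rels_carrier]])
  have sub: "eps_rels N q s \<subseteq> ?I"
    by (rule rel_ideal_self[OF eps_rels_carrier])
  have e: "falg_subst to_eps (av i m) = (\<Sum>l=1..N. sc (ac m i l) * ep l m)" if "i \<in> {1..N}" for i m
    using that by (simp add: to_eps_def a_elt_eq_sum)
  \<comment> \<open>The epsilon_{lm} have the identity as Gram matrix, so the double sum collapses
    to A(m) A(-m)^T.\<close>
  have gram: "(\<Sum>k=1..N. \<Sum>l=1..N. ac m i k * ac (- m) j l * (if k = l then 1 else 0))
    = a_gram q m i j" if "i \<in> {1..N}" "j \<in> {1..N}" "m \<noteq> 0" for i j m
    using a_coeff_gram[OF that] by (simp add: if_distrib[of "\<lambda>x. _ * x"] cong: if_cong)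
  have "heis_rels N q (\<lambda>i m. falg_subst to_eps (av i m)) (a_gram q) \<subseteq> ?I"
    by (rule heis_rels_change[OF S order_trans[OF heis_rels_subset_eps_rels sub] e gram])
  moreover have "x_rels N q (\<lambda>i m. falg_subst to_eps (av i m)) (a_x_coeff q) \<subseteq> ?I"
    by (rule x_rels_change[OF S order_trans[OF x_rels_subset_eps_rels sub] e a_coeff_x])
  moreover have "falg_subst to_eps p \<in> ?I" if "p \<in> common_rels N q (a_gens N) (h_a q)"
  proof (rule to_eps.subst_common_rels[OF subst_to_eps_h_a _ _ that])
    show "common_rels N q (eps_gens N) (h_eps s) \<subseteq> ?I"
      using common_rels_subset(1) sub by blast
    have central: "comm (var (Qc Pl)) (var g) \<in> ?I" if "g \<in> eps_gens N" for g
      using sub that unfolding eps_rels_def common_rels_def rels_central_def by blast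
    fix g assume g: "g \<in> a_gens N"
    show "comm (var (Qc Pl)) (to_eps g) \<in> ?I"
    proof (cases "g \<in> common_gens N")
      case True
      then show ?thesis using central[of g] common_gens_subset(1)[of N] by (auto simp: to_eps_common)
    next
      case False
      then obtain i m where g: "g = Ag i m" "i \<in> {1..N}" "m \<noteq> 0"
        using g unfolding a_gens_def by auto
      have "to_eps g = (\<Sum>l=1..N. sc (ac m i l) * ep l m)"
        using g(2) by (simp add: g(1) to_eps_def a_elt_eq_sum)
      then show ?thesis
        by (simp only:) (rule lin_closed_central[OF S central], use g in simp)
    qed
  qed
  ultimately show ?thesis
    using assms a_rels_subset[of N q] to_eps.subst_heis_rels[of p] to_eps.subst_x_rels[of p] by blast
qed

end

theorem theorem4p16:
  fixes N :: nat and q s :: complex and r :: "nat \<Rightarrow> complex"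
  assumes "N \<ge> 3"
    and "generic q"
    and "s ^ 2 = q"
    and "\<And>k. k \<ge> 1 \<Longrightarrow> (r k) ^ 2 = (\<Sum>l<N. q ^ (2 * l * k))"
  shows "\<exists>\<phi> \<in> alg_iso (Uq_gl N q s) (a_alg N q).
    (\<forall>i \<in> {1..N}. \<forall>m. m \<noteq> 0 \<longrightarrow>
        \<phi> (U_cls N q s (a_elt N q s r i m)) = a_cls N q (var (Ag i m))) \<and>
    (\<forall>g \<in> common_gens N. \<phi> (U_cls N q s (var g)) = a_cls N q (var g))"
proof -
  interpret gl_params N q s r
    using assms by unfold_locales auto
  obtain \<phi> where iso: "\<phi> \<in> alg_iso (Uq_gl N q s) (a_alg N q)"
    and \<phi>: "\<And>p. p \<in> fcar (eps_gens N) \<Longrightarrow> \<phi> (U_cls N q s p) = a_cls N q (falg_subst to_a p)"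
    using presented_alg_iso[OF eps_rels_carrier a_rels_carrier to_a_closed to_eps_closed
        subst_to_a_rels subst_to_eps_rels subst_to_eps_to_a subst_to_a_to_eps]
    unfolding Uq_gl_def a_alg_def U_cls_def a_cls_def by blast
  have "\<phi> (U_cls N q s (a_elt N q s r i m)) = a_cls N q (var (Ag i m))"
    if im: "i \<in> {1..N}" "m \<noteq> 0" for i m
  proof -
    have "a_elt N q s r i m \<in> fcar (eps_gens N)"
      using to_eps_closed[of "Ag i m"] im by (simp add: to_eps_def)
    then show ?thesis using \<phi> subst_to_a_a_elt[OF im] by simp
  qed
  moreover have "\<phi> (U_cls N q s (var g)) = a_cls N q (var g)" if "g \<in> common_gens N" for g
    using \<phi>[of "var g"] common_gens_subset(1)[of N] that by (auto simp: to_a_common)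
  ultimately show ?thesis using iso by blast
qed

end
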